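(* Let $A$ be a bounded linear operator on $H^2$. For a nonconstant inner function $\alpha$ put $A_\alpha=P_\alpha A|_{K^2_\alpha}\colon K^2_\alpha\to K^2_\alpha$. The following are equivalent: (1) $A=T_\varphi$ for some $\varphi\in L^\infty$; (2) $C_\alpha A_\alpha C_\alpha=A_\alpha^*$ for every nonconstant inner function $\alpha$; (3) $C_\alpha A_\alpha C_\alpha=A_\alpha^*$ for every $\alpha=z^n$, $n\in\mathbb{N}$.
   Context: $L^2=L^2(\mathbb{T},m)$, $L^\infty=L^\infty(\mathbb{T},m)$ with $m$ normalized Lebesgue measure on the unit circle; $P\colon L^2\to H^2$ is the orthogonal projection and the Toeplitz operator with symbol $\varphi\in L^\infty$ is $T_\varphi f=P(\varphi f)$, $f\in H^2$. For a nonconstant inner $\alpha$, $K^2_\alpha=H^2\ominus\alpha H^2$, $P_\alpha$ is the orthogonal projection onto $K^2_\alpha$, and $C_\alpha f(z)=\alpha(z)\overline{zf(z)}$ ($|z|=1$) is a conjugation on $K^2_\alpha$. *)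

theory Defs
  imports "HOL-Analysis.Analysis"
begin

text \<open>The unit circle T is parametrised by t in [0,1] via z = cis(2 pi t);
  normalised Lebesgue measure m on T corresponds to Lebesgue measure on [0,1].
  Functions on T are thus functions real => complex, considered on [0,1],
  and all identities between elements of L^2 are understood almost everywhere.\<close>

definition circ :: "real measure" where
  "circ = restrict_space lborel {0..1}"

definition zc :: "real \<Rightarrow> complex" where
  "zc t = cis (2 * pi * t)"

definition L2 :: "(real \<Rightarrow> complex) set" where
  "L2 = {f. f \<in> borel_measurable circ \<and> integrable circ (\<lambda>t. (cmod (f t))\<^sup>2)}"

definition Linf :: "(real \<Rightarrow> complex) set" where
  "Linf = {f. f \<in> borel_measurable circ \<and> (\<exists>B. AE t in circ. cmod (f t) \<le> B)}"

definition ip :: "(real \<Rightarrow> complex) \<Rightarrow> (real \<Rightarrow> complex) \<Rightarrow> complex" where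
  "ip f g = integral\<^sup>L circ (\<lambda>t. f t * cnj (g t))"

definition L2norm :: "(real \<Rightarrow> complex) \<Rightarrow> real" where
  "L2norm f = sqrt (integral\<^sup>L circ (\<lambda>t. (cmod (f t))\<^sup>2))"

definition fcoef :: "(real \<Rightarrow> complex) \<Rightarrow> int \<Rightarrow> complex" where
  "fcoef f n = integral\<^sup>L circ (\<lambda>t. f t * cis (- 2 * pi * of_int n * t))"

definition H2 :: "(real \<Rightarrow> complex) set" where
  "H2 = {f \<in> L2. \<forall>n::int. n < 0 \<longrightarrow> fcoef f n = 0}"

text \<open>Orthogonal projection of L^2 onto a subspace S (determined up to a.e. equality).\<close>
definition proj :: "(real \<Rightarrow> complex) set \<Rightarrow> (real \<Rightarrow> complex) \<Rightarrow> (real \<Rightarrow> complex)" where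
  "proj S h = (SOME g. g \<in> S \<and> (\<forall>k\<in>S. ip (\<lambda>t. h t - g t) k = 0))"

definition P :: "(real \<Rightarrow> complex) \<Rightarrow> (real \<Rightarrow> complex)" where
  "P = proj H2"

definition toeplitz :: "(real \<Rightarrow> complex) \<Rightarrow> (real \<Rightarrow> complex) \<Rightarrow> (real \<Rightarrow> complex)" where
  "toeplitz \<phi> f = P (\<lambda>t. \<phi> t * f t)"

text \<open>Inner functions: bounded analytic (H^infinity = L^infinity \<inter> H^2) with
  unimodular boundary values a.e.\<close>
definition inner_fun :: "(real \<Rightarrow> complex) \<Rightarrow> bool" where
  "inner_fun \<alpha> \<longleftrightarrow> \<alpha> \<in> Linf \<and> \<alpha> \<in> H2 \<and> (AE t in circ. cmod (\<alpha> t) = 1)"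

definition nonconstant :: "(real \<Rightarrow> complex) \<Rightarrow> bool" where
  "nonconstant \<alpha> \<longleftrightarrow> \<not> (\<exists>c. AE t in circ. \<alpha> t = c)"

definition K2 :: "(real \<Rightarrow> complex) \<Rightarrow> (real \<Rightarrow> complex) set" where
  "K2 \<alpha> = {f \<in> H2. \<forall>g\<in>H2. ip f (\<lambda>t. \<alpha> t * g t) = 0}"

definition P_alpha :: "(real \<Rightarrow> complex) \<Rightarrow> (real \<Rightarrow> complex) \<Rightarrow> (real \<Rightarrow> complex)" where
  "P_alpha \<alpha> = proj (K2 \<alpha>)"

definition C_alpha :: "(real \<Rightarrow> complex) \<Rightarrow> (real \<Rightarrow> complex) \<Rightarrow> (real \<Rightarrow> complex)" where
  "C_alpha \<alpha> f = (\<lambda>t. \<alpha> t * cnj (zc t * f t))"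

definition compr :: "((real \<Rightarrow> complex) \<Rightarrow> (real \<Rightarrow> complex)) \<Rightarrow> (real \<Rightarrow> complex)
    \<Rightarrow> (real \<Rightarrow> complex) \<Rightarrow> (real \<Rightarrow> complex)" where
  "compr A \<alpha> f = P_alpha \<alpha> (A f)"

definition is_adjoint_on :: "(real \<Rightarrow> complex) set \<Rightarrow> ((real \<Rightarrow> complex) \<Rightarrow> (real \<Rightarrow> complex))
    \<Rightarrow> ((real \<Rightarrow> complex) \<Rightarrow> (real \<Rightarrow> complex)) \<Rightarrow> bool" where
  "is_adjoint_on S B B' \<longleftrightarrow> (\<forall>f\<in>S. B' f \<in> S) \<and> (\<forall>f\<in>S. \<forall>g\<in>S. ip (B' f) g = ip f (B g))"

definition conj_symm :: "((real \<Rightarrow> complex) \<Rightarrow> (real \<Rightarrow> complex)) \<Rightarrow> (real \<Rightarrow> complex) \<Rightarrow> bool" where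
  "conj_symm A \<alpha> \<longleftrightarrow>
     is_adjoint_on (K2 \<alpha>) (compr A \<alpha>) (\<lambda>f. C_alpha \<alpha> (compr A \<alpha> (C_alpha \<alpha> f)))"

text \<open>Bounded linear operator on H^2 (acting on representatives, compatible with a.e. equality).\<close>
definition bounded_op_H2 :: "((real \<Rightarrow> complex) \<Rightarrow> (real \<Rightarrow> complex)) \<Rightarrow> bool" where
  "bounded_op_H2 A \<longleftrightarrow>
     (\<forall>f\<in>H2. A f \<in> H2) \<and>
     (\<forall>f\<in>H2. \<forall>g\<in>H2. (AE t in circ. f t = g t) \<longrightarrow> (AE t in circ. A f t = A g t)) \<and>
     (\<forall>f\<in>H2. \<forall>g\<in>H2. \<forall>a b. AE t in circ. A (\<lambda>s. a * f s + b * g s) t = a * A f t + b * A g t) \<and>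
     (\<exists>C. \<forall>f\<in>H2. L2norm (A f) \<le> C * L2norm f)"

end

theory Submission
  imports Defs
begin

text \<open>
  Since \<open>C\<^sub>\<alpha>\<close> is an isometric conjugation of \<open>K2 \<alpha>\<close>, the symmetry of the compression of \<open>A\<close> says that
  \<open>\<langle>A C\<^sub>\<alpha> f, C\<^sub>\<alpha> g\<rangle> = \<langle>A g, f\<rangle>\<close> on \<open>K2 \<alpha>\<close>. For \<open>A = T\<^sub>\<phi>\<close> both sides are the integral of
  \<open>\<phi> \<cdot> g \<cdot> cnj f\<close>, because \<open>\<bar>\<alpha>\<bar> = 1\<close>. For \<open>\<alpha> = z\<^sup>n\<close> the conjugation maps \<open>z\<^sup>j\<close> to \<open>z\<^sup>n\<^sup>-\<^sup>1\<^sup>-\<^sup>j\<close>, and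
  comparing \<open>n\<close> with \<open>n + 1\<close> shows that the matrix of \<open>A\<close> is constant along diagonals.
  By Brown and Halmos such an operator is a Toeplitz operator: its diagonals are square summable, hence
  they are the Fourier coefficients of some \<open>\<phi>\<close> in \<open>L2\<close>, and the Fejer means of \<open>\<phi>\<close> are
  Rayleigh quotients of \<open>A\<close>, so they, and with them \<open>\<phi>\<close>, are bounded by the norm of \<open>A\<close>.
\<close>

subsection \<open>Characters of the circle\<close>

lemma space_circ [simp]: "space circ = {0..1}"
  by (simp add: circ_def space_restrict_space)

lemma measure_circ [simp]: "measure circ {0..1} = 1"
  unfolding circ_def by (subst measure_restrict_space) auto

interpretation circ: finite_measure circ
  by (rule finite_measureI) (simp add: circ_def emeasure_restrict_space space_restrict_space)

lemma borel_measurable_circI: "f \<in> borel_measurable borel \<Longrightarrow> f \<in> borel_measurable circ"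
  unfolding circ_def by (rule measurable_restrict_space1) simp

lemma cnj_measurable [measurable]: "cnj \<in> borel_measurable borel"
  by (intro borel_measurable_continuous_onI continuous_intros)

text \<open>The monomials z^n for all integers n. Allowing negative exponents keeps the family
  closed under products and conjugation.\<close>

definition chi :: "int \<Rightarrow> real \<Rightarrow> complex" where
  "chi n t = cis (2 * pi * of_int n * t)"

lemma chi_measurable [measurable]: "chi n \<in> borel_measurable circ"
proof (rule borel_measurable_circI, rule borel_measurable_continuous_onI)
  show "continuous_on UNIV (chi n)"
    unfolding chi_def by (intro continuous_intros)
qed

lemma norm_chi [simp]: "cmod (chi n t) = 1"
  by (simp add: chi_def)

lemma chi_mult: "chi m t * chi n t = chi (m + n) t"
  by (simp add: chi_def cis_mult algebra_simps)

lemma cnj_chi: "cnj (chi n t) = chi (- n) t"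
  by (simp add: chi_def cis_cnj)

lemma chi_0 [simp]: "chi 0 t = 1"
  by (simp add: chi_def)

lemma zc_eq_chi: "zc t = chi 1 t"
  by (simp add: zc_def chi_def)

lemma chi_power: "chi m t ^ n = chi (m * int n) t"
  by (simp add: chi_def Complex.DeMoivre algebra_simps)

lemma zc_power: "zc t ^ n = chi (int n) t"
  by (simp add: zc_eq_chi chi_power)

lemma fcoef_eq: "fcoef f n = ip f (chi n)"
  unfolding fcoef_def ip_def chi_def by (simp add: cis_cnj)

text \<open>For nonzero n the character has the antiderivative
  \<open>chi n t / (2 * pi * \<i> * n)\<close>, which takes equal values at 0 and 1.\<close>

lemma integral_chi: "integral\<^sup>L circ (chi n) = (if n = 0 then 1 else 0)"
proof (cases "n = 0")
  case True
  then have "chi n = (\<lambda>_. 1)" by auto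
  then show ?thesis using True by simp
next
  case False
  have "integral\<^sup>L circ (chi n) = (\<integral>t. indicator {0..1} t *\<^sub>R chi n t \<partial>lborel)"
    unfolding circ_def by (subst integral_restrict_space) auto
  also have "\<dots> = chi n 1 / (2 * pi * \<i> * of_int n) - chi n 0 / (2 * pi * \<i> * of_int n)"
  proof (rule integral_FTC_Icc)
    fix x :: real
    define c where "c = 2 * pi * of_int n"
    have c: "chi n = (\<lambda>t. cis (c * t))" "2 * pi * \<i> * of_int n = \<i> * of_real c" "c \<noteq> 0"
      using False by (auto simp: c_def chi_def)
    have "((\<lambda>t. cis (c * t)) has_vector_derivative c *\<^sub>R (\<i> * cis (c * x))) (at x within {0..1})"
      unfolding has_vector_derivative_def
      by (rule derivative_eq_intros refl)+ (simp add: fun_eq_iff mult.commute)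
    from has_vector_derivative_divide[OF this, of "\<i> * of_real c"]
    show "((\<lambda>t. chi n t / (2 * pi * \<i> * of_int n)) has_vector_derivative chi n x) (at x within {0..1})"
      using c(3) unfolding c(1,2) by (simp add: scaleR_conv_of_real)
  next
    show "continuous_on {0..1} (chi n)"
      unfolding chi_def by (intro continuous_intros)
  qed simp
  also have "chi n 1 = 1"
    using cis_multiple_2pi[of "of_int n"] by (simp add: chi_def)
  also have "chi n 0 = 1"
    by (simp add: chi_def)
  finally show ?thesis using False by simp
qed

subsection \<open>The space of square integrable functions\<close>

lemma L2_measurable [measurable_dest]: "f \<in> L2 \<Longrightarrow> f \<in> borel_measurable circ"
  by (simp add: L2_def)

lemma L2_integrable_sq: "f \<in> L2 \<Longrightarrow> integrable circ (\<lambda>t. (cmod (f t))\<^sup>2)"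
  by (simp add: L2_def)

lemma mult_le_sum_squares: "x * y \<le> x\<^sup>2 + y\<^sup>2" if "x \<ge> 0" "y \<ge> 0" for x y :: real
  using sum_squares_bound[of x y] zero_le_power2[of x] zero_le_power2[of y] mult_nonneg_nonneg[OF that] by linarith

lemma L2_integrable_mult_norm:
  assumes "f \<in> L2" "g \<in> L2"
  shows "integrable circ (\<lambda>t. cmod (f t) * cmod (g t))"
proof (rule Bochner_Integration.integrable_bound)
  show "integrable circ (\<lambda>t. (cmod (f t))\<^sup>2 + (cmod (g t))\<^sup>2)"
    using assms by (intro Bochner_Integration.integrable_add L2_integrable_sq)
  show "(\<lambda>t. cmod (f t) * cmod (g t)) \<in> borel_measurable circ"
    using assms by measurable
qed (auto simp: mult_le_sum_squares)

lemma L2_integrable_mult_cnj: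
  assumes "f \<in> L2" "g \<in> L2"
  shows "integrable circ (\<lambda>t. f t * cnj (g t))"
  by (rule Bochner_Integration.integrable_bound[OF L2_integrable_mult_norm[OF assms]])
     (use assms in \<open>auto simp: norm_mult\<close>)

lemma L2_add:
  assumes "f \<in> L2" "g \<in> L2"
  shows "(\<lambda>t. f t + g t) \<in> L2"
proof -
  have "integrable circ (\<lambda>t. (cmod (f t + g t))\<^sup>2)"
  proof (rule Bochner_Integration.integrable_bound)
    show "integrable circ (\<lambda>t. (cmod (f t))\<^sup>2 + (cmod (g t))\<^sup>2 + 2 * (cmod (f t) * cmod (g t)))"
      using assms by (intro Bochner_Integration.integrable_add L2_integrable_sq
          integrable_mult_right L2_integrable_mult_norm)
    have "(cmod (f t + g t))\<^sup>2 \<le> (cmod (f t) + cmod (g t))\<^sup>2" for t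
      by (intro power_mono norm_triangle_ineq) auto
    then show "AE t in circ. norm ((cmod (f t + g t))\<^sup>2)
        \<le> norm ((cmod (f t))\<^sup>2 + (cmod (g t))\<^sup>2 + 2 * (cmod (f t) * cmod (g t)))"
      by (auto simp: power2_sum algebra_simps)
  qed (use assms in measurable)
  then show ?thesis using assms unfolding L2_def by auto
qed

lemma L2_cnj: "f \<in> L2 \<Longrightarrow> (\<lambda>t. cnj (f t)) \<in> L2"
  unfolding L2_def by (auto intro: measurable_compose[OF _ cnj_measurable])

lemma Linf_measurable [measurable_dest]: "f \<in> Linf \<Longrightarrow> f \<in> borel_measurable circ"
  by (simp add: Linf_def)

lemma Linf_mult_L2:
  assumes "\<phi> \<in> Linf" "f \<in> L2"
  shows "(\<lambda>t. \<phi> t * f t) \<in> L2"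
proof -
  obtain B where B: "AE t in circ. cmod (\<phi> t) \<le> B"
    using assms by (auto simp: Linf_def)
  have "integrable circ (\<lambda>t. (cmod (\<phi> t * f t))\<^sup>2)"
  proof (rule Bochner_Integration.integrable_bound)
    show "integrable circ (\<lambda>t. B\<^sup>2 * (cmod (f t))\<^sup>2)"
      by (intro integrable_mult_right L2_integrable_sq assms)
    show "AE t in circ. norm ((cmod (\<phi> t * f t))\<^sup>2) \<le> norm (B\<^sup>2 * (cmod (f t))\<^sup>2)"
      using B by eventually_elim (auto simp: norm_mult power_mult_distrib intro!: mult_right_mono power_mono)
  qed (use assms in measurable)
  then show ?thesis using assms unfolding L2_def by auto
qed

lemma const_Linf: "(\<lambda>_. c) \<in> Linf"
  by (auto simp: Linf_def)

lemma chi_Linf: "chi n \<in> Linf"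
  unfolding Linf_def by (auto intro!: exI[of _ 1])

lemma cnj_Linf: "\<phi> \<in> Linf \<Longrightarrow> (\<lambda>t. cnj (\<phi> t)) \<in> Linf"
  unfolding Linf_def by (auto intro: measurable_compose[OF _ cnj_measurable])

lemma one_L2: "(\<lambda>_. 1) \<in> L2"
  by (auto simp: L2_def)

lemma Linf_L2: "\<phi> \<in> Linf \<Longrightarrow> \<phi> \<in> L2"
  using Linf_mult_L2[OF _ one_L2] by simp

lemma chi_L2 [simp]: "chi n \<in> L2"
  by (rule Linf_L2[OF chi_Linf])

lemma L2_cmult: "f \<in> L2 \<Longrightarrow> (\<lambda>t. c * f t) \<in> L2"
  by (rule Linf_mult_L2[OF const_Linf])

lemma L2_diff:
  assumes "f \<in> L2" "g \<in> L2"
  shows "(\<lambda>t. f t - g t) \<in> L2"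
  using L2_add[OF assms(1) L2_cmult[OF assms(2), of "-1"]] by simp

lemma zero_L2: "(\<lambda>_. 0) \<in> L2"
  using L2_cmult[OF one_L2, of 0] by simp

lemma L2_sum:
  assumes "\<And>i. i \<in> I \<Longrightarrow> h i \<in> L2"
  shows "(\<lambda>t. \<Sum>i\<in>I. h i t) \<in> L2"
  using assms by (induction I rule: infinite_finite_induct) (auto simp: zero_L2 L2_add)

section \<open>Sesquilinearity of the inner product\<close>

lemma L2_integrable: "f \<in> L2 \<Longrightarrow> integrable circ f"
  using L2_integrable_mult_cnj[OF _ one_L2] by simp

lemma ip_cnj: "cnj (ip f g) = ip g f"
  unfolding ip_def by (subst Bochner_Integration.integral_cnj[symmetric]) (simp add: mult.commute)

lemma ip_add_left: "\<lbrakk>f \<in> L2; g \<in> L2; h \<in> L2\<rbrakk> \<Longrightarrow> ip (\<lambda>t. f t + g t) h = ip f h + ip g h"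
  unfolding ip_def by (simp add: distrib_right L2_integrable_mult_cnj)

lemma ip_diff_left: "\<lbrakk>f \<in> L2; g \<in> L2; h \<in> L2\<rbrakk> \<Longrightarrow> ip (\<lambda>t. f t - g t) h = ip f h - ip g h"
  unfolding ip_def by (simp add: left_diff_distrib L2_integrable_mult_cnj)

lemma ip_cmult_left: "ip (\<lambda>t. c * f t) h = c * ip f h"
  unfolding ip_def by (simp add: mult.assoc)

lemma ip_sum_left:
  assumes "\<And>i. i \<in> I \<Longrightarrow> h i \<in> L2" "g \<in> L2"
  shows "ip (\<lambda>t. \<Sum>i\<in>I. c i * h i t) g = (\<Sum>i\<in>I. c i * ip (h i) g)"
  using assms(1)
proof (induction I rule: infinite_finite_induct)
  case (insert x F)
  then show ?case
    by (simp add: ip_add_left L2_cmult L2_sum assms(2) ip_cmult_left)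
qed (simp_all add: ip_def)

lemma ip_sum_right:
  assumes "\<And>i. i \<in> I \<Longrightarrow> h i \<in> L2" "g \<in> L2"
  shows "ip g (\<lambda>t. \<Sum>i\<in>I. c i * h i t) = (\<Sum>i\<in>I. cnj (c i) * ip g (h i))"
proof -
  have "ip g (\<lambda>t. \<Sum>i\<in>I. c i * h i t) = cnj (ip (\<lambda>t. \<Sum>i\<in>I. c i * h i t) g)"
    by (rule ip_cnj[symmetric])
  also have "ip (\<lambda>t. \<Sum>i\<in>I. c i * h i t) g = (\<Sum>i\<in>I. c i * ip (h i) g)"
    using assms by (rule ip_sum_left)
  finally show ?thesis by (simp add: ip_cnj)
qed

lemma ip_cong_AE:
  assumes "AE t in circ. f t * cnj (g t) = f' t * cnj (g' t)"
    and "f \<in> L2" "g \<in> L2" "f' \<in> L2" "g' \<in> L2"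
  shows "ip f g = ip f' g'"
  unfolding ip_def using assms
  by (intro integral_cong_AE borel_measurable_integrable L2_integrable_mult_cnj)

lemma ip_chi_chi: "ip (chi m) (chi n) = (if m = n then 1 else 0)"
  unfolding ip_def by (simp add: cnj_chi chi_mult integral_chi)

section \<open>Norm inequalities in L2\<close>

lemma L2norm_nonneg [simp]: "L2norm f \<ge> 0"
  by (simp add: L2norm_def)

lemma L2norm_sq: "(L2norm f)\<^sup>2 = integral\<^sup>L circ (\<lambda>t. (cmod (f t))\<^sup>2)"
  by (simp add: L2norm_def)

lemma ip_self: "ip f f = of_real ((L2norm f)\<^sup>2)"
  unfolding ip_def L2norm_sq integral_complex_of_real[symmetric] complex_norm_square ..

lemma L2norm_cong_AE:
  assumes "AE t in circ. f t = g t" "f \<in> L2" "g \<in> L2"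
  shows "L2norm f = L2norm g"
  unfolding L2norm_def
  by (rule arg_cong[of _ _ sqrt], rule integral_cong_AE) (use assms in auto)

lemma L2norm_eq_0_AE:
  assumes "f \<in> L2" "L2norm f = 0"
  shows "AE t in circ. f t = 0"
proof -
  have "integral\<^sup>L circ (\<lambda>t. (cmod (f t))\<^sup>2) = 0"
    using assms(2) by (simp add: L2norm_def)
  then show ?thesis
    using integral_nonneg_eq_0_iff_AE[OF L2_integrable_sq[OF assms(1)]] by simp
qed

text \<open>Cauchy-Schwarz for the moduli. From it come the bound on \<open>ip\<close>, the
  comparison of the L1 and L2 norms, and the triangle inequality.\<close>

lemma integral_mult_norm_le:
  assumes "f \<in> L2" "g \<in> L2"
  shows "(\<integral>t. cmod (f t) * cmod (g t) \<partial>circ) \<le> L2norm f * L2norm g"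
proof (cases "L2norm f = 0 \<or> L2norm g = 0")
  case True
  then have "AE t in circ. cmod (f t) * cmod (g t) = 0"
    using L2norm_eq_0_AE[OF assms(1)] L2norm_eq_0_AE[OF assms(2)] by auto
  then have "(\<integral>t. cmod (f t) * cmod (g t) \<partial>circ) = 0"
    using assms by (subst integral_cong_AE[where g = "\<lambda>_. 0"]) auto
  then show ?thesis by simp
next
  case False
  \<comment> \<open>Each function is weighted by the norm of the other, so both quadratic terms of
    the integrated square equal (x y)^2 and a factor x y > 0 can be cancelled.\<close>
  define x y I where "x = L2norm g" and "y = L2norm f"
    and "I = (\<integral>t. cmod (f t) * cmod (g t) \<partial>circ)"
  have pos: "x * y > 0"
    using False by (simp add: x_def y_def less_le)
  have eq: "(x * cmod (f t) - y * cmod (g t))\<^sup>2 = x\<^sup>2 * (cmod (f t))\<^sup>2 + y\<^sup>2 * (cmod (g t))\<^sup>2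
      - 2 * x * y * (cmod (f t) * cmod (g t))" for t
    by (simp add: power2_eq_square algebra_simps)
  have "0 \<le> (\<integral>t. (x * cmod (f t) - y * cmod (g t))\<^sup>2 \<partial>circ)"
    by (rule Bochner_Integration.integral_nonneg) simp
  also have "\<dots> = x\<^sup>2 * y\<^sup>2 + y\<^sup>2 * x\<^sup>2 - 2 * x * y * I"
    unfolding eq using assms
    by (simp add: L2_integrable_sq L2_integrable_mult_norm I_def
        L2norm_sq[symmetric] x_def[symmetric] y_def[symmetric])
  finally have "(x * y) * I \<le> (x * y) * (x * y)"
    by (simp add: power2_eq_square algebra_simps)
  then have "I \<le> x * y"
    using pos mult_le_cancel_left_pos by blast
  then show ?thesis by (simp add: I_def x_def y_def mult.commute)
qed

lemma ip_Cauchy_Schwarz: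
  assumes "f \<in> L2" "g \<in> L2"
  shows "cmod (ip f g) \<le> L2norm f * L2norm g"
proof -
  have "cmod (ip f g) \<le> (\<integral>t. cmod (f t * cnj (g t)) \<partial>circ)"
    unfolding ip_def by (rule integral_norm_bound)
  also have "\<dots> = (\<integral>t. cmod (f t) * cmod (g t) \<partial>circ)"
    by (simp add: norm_mult)
  finally show ?thesis
    using integral_mult_norm_le[OF assms] by simp
qed

text \<open>Cauchy-Schwarz against the constant 1. The bound gives access to almost everywhere
  convergent subsequences, which are extracted from L1 convergence.\<close>

lemma L1_le_L2norm:
  assumes "f \<in> L2"
  shows "(\<integral>t. cmod (f t) \<partial>circ) \<le> L2norm f"
  using integral_mult_norm_le[OF assms one_L2] by (simp add: L2norm_def)

lemma L2norm_triangle: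
  assumes "f \<in> L2" "g \<in> L2"
  shows "L2norm (\<lambda>t. f t + g t) \<le> L2norm f + L2norm g"
proof (rule power2_le_imp_le)
  have "(L2norm (\<lambda>t. f t + g t))\<^sup>2 = (\<integral>t. (cmod (f t + g t))\<^sup>2 \<partial>circ)"
    by (rule L2norm_sq)
  also have "\<dots> \<le> (\<integral>t. (cmod (f t))\<^sup>2 + (cmod (g t))\<^sup>2 + 2 * (cmod (f t) * cmod (g t)) \<partial>circ)"
  proof (rule integral_mono)
    show "(cmod (f t + g t))\<^sup>2 \<le> (cmod (f t))\<^sup>2 + (cmod (g t))\<^sup>2 + 2 * (cmod (f t) * cmod (g t))" for t
      using power_mono[OF norm_triangle_ineq[of "f t" "g t"], of 2]
      by (simp add: power2_sum algebra_simps)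
  qed (auto intro!: L2_integrable_sq L2_add L2_integrable_mult_norm assms)
  also have "\<dots> = (L2norm f)\<^sup>2 + (L2norm g)\<^sup>2 + 2 * (\<integral>t. cmod (f t) * cmod (g t) \<partial>circ)"
    unfolding L2norm_sq using assms by (simp add: L2_integrable_sq L2_integrable_mult_norm)
  also have "\<dots> \<le> (L2norm f + L2norm g)\<^sup>2"
    using integral_mult_norm_le[OF assms] by (simp add: power2_sum)
  finally show "(L2norm (\<lambda>t. f t + g t))\<^sup>2 \<le> (L2norm f + L2norm g)\<^sup>2" .
qed simp

lemma L2norm_cmult: "L2norm (\<lambda>t. c * f t) = cmod c * L2norm f"
  unfolding L2norm_def by (simp add: norm_mult power_mult_distrib real_sqrt_mult)

lemma L2norm_minus_commute: "L2norm (\<lambda>t. f t - g t) = L2norm (\<lambda>t. g t - f t)"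
  unfolding L2norm_def by (simp add: norm_minus_commute)

lemma L2norm_sum:
  assumes "\<And>i. i \<in> I \<Longrightarrow> h i \<in> L2"
  shows "L2norm (\<lambda>t. \<Sum>i\<in>I. h i t) \<le> (\<Sum>i\<in>I. L2norm (h i))"
  using assms
proof (induction I rule: infinite_finite_induct)
  case (insert x F)
  have "L2norm (\<lambda>t. \<Sum>i\<in>insert x F. h i t) \<le> L2norm (h x) + L2norm (\<lambda>t. \<Sum>i\<in>F. h i t)"
    using insert by (auto intro!: L2norm_triangle L2_sum)
  then show ?case using insert by force
qed (simp_all add: L2norm_def)

lemma ip_tendsto_left:
  assumes "\<And>n. s n \<in> L2" "f \<in> L2" "g \<in> L2"
    and "(\<lambda>n. L2norm (\<lambda>t. s n t - f t)) \<longlonglongrightarrow> 0"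
  shows "(\<lambda>n. ip (s n) g) \<longlonglongrightarrow> ip f g"
proof (rule LIM_zero_cancel, rule Lim_null_comparison)
  show "\<forall>\<^sub>F n in sequentially. norm (ip (s n) g - ip f g) \<le> L2norm (\<lambda>t. s n t - f t) * L2norm g"
    using ip_Cauchy_Schwarz[OF L2_diff[OF assms(1,2)] assms(3)]
    by (simp add: ip_diff_left assms)
  show "(\<lambda>n. L2norm (\<lambda>t. s n t - f t) * L2norm g) \<longlonglongrightarrow> 0"
    using tendsto_mult_right[OF assms(4), of "L2norm g"] by simp
qed

subsection \<open>Uniqueness of Fourier coefficients\<close>

lemma integrable_chi_mult:
  assumes "integrable circ f"
  shows "integrable circ (\<lambda>t. chi n t * f t)"
  by (rule Bochner_Integration.integrable_bound[OF assms])
     (use assms in \<open>auto simp: norm_mult\<close>)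

lemma fcoef_chi_mult: "fcoef (\<lambda>t. chi m t * f t) n = fcoef f (n - m)"
proof -
  have "chi m t * f t * chi (- n) t = f t * chi (m - n) t" for t
    using chi_mult[of m t "- n"] by (simp add: mult_ac)
  then show ?thesis unfolding fcoef_eq ip_def cnj_chi minus_diff_eq by (simp only:)
qed

lemma fcoef_add:
  assumes "integrable circ f" "integrable circ g"
  shows "fcoef (\<lambda>t. f t + g t) n = fcoef f n + fcoef g n"
  using integrable_chi_mult[OF assms(1), of "- n"] integrable_chi_mult[OF assms(2), of "- n"]
  by (simp add: fcoef_eq ip_def cnj_chi distrib_left mult.commute[of _ "chi (- n) _"])

lemma fcoef_cmult: "fcoef (\<lambda>t. c * f t) n = c * fcoef f n"
  by (simp add: fcoef_eq ip_cmult_left)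

text \<open>Multiplication by a character only shifts the coefficients, so their vanishing survives
  multiplication by any polynomial in Re z and Im z. The induction needs \<open>f\<close> arbitrary,
  since a product p q is handled by applying the hypothesis for p to q f.\<close>

lemma fcoef_zero_mult_polynomial:
  fixes p :: "complex \<Rightarrow> real"
  assumes "real_polynomial_function p" "integrable circ f" "\<And>n. fcoef f n = 0"
  shows "integrable circ (\<lambda>t. of_real (p (zc t)) * f t) \<and>
         (\<forall>n. fcoef (\<lambda>t. of_real (p (zc t)) * f t) n = 0)"
  using assms
proof (induction p arbitrary: f rule: real_polynomial_function.induct)
  case (linear p)
  interpret bounded_linear p by fact
  \<comment> \<open>A real-linear functional satisfies p w = Re w * p 1 + Im w * p \<i>; rewritten
    as a w + b cnj w it becomes a combination of \<open>chi 1\<close> and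
    \<open>chi (- 1)\<close>.\<close>
  define a b :: complex where "a = (p 1 - \<i> * p \<i>) / 2" and "b = (p 1 + \<i> * p \<i>) / 2"
  have "of_real (p (zc t)) = a * chi 1 t + b * chi (- 1) t" for t
  proof -
    define w where "w = chi 1 t"
    have w: "zc t = w" "chi 1 t = w" "chi (- 1) t = cnj w"
      by (simp_all add: w_def zc_eq_chi cnj_chi)
    have "w = Re w *\<^sub>R 1 + Im w *\<^sub>R \<i>"
      by (simp add: complex_eq_iff)
    then have "p w = Re w * p 1 + Im w * p \<i>"
      by (metis add real_scaleR_def scaleR)
    then show ?thesis unfolding w by (simp add: a_def b_def complex_eq_iff field_simps)
  qed
  then have eq: "(\<lambda>t. of_real (p (zc t)) * f t) = (\<lambda>t. a * (chi 1 t * f t) + b * (chi (- 1) t * f t))"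
    by (simp add: fun_eq_iff algebra_simps)
  have i: "integrable circ (\<lambda>t. c * (chi n t * f t))" for c n
    by (intro integrable_mult_right integrable_chi_mult linear.prems)
  show ?case unfolding eq
    by (simp add: i fcoef_add fcoef_cmult fcoef_chi_mult linear.prems)
next
  case (const c)
  then show ?case by (simp add: fcoef_cmult)
next
  case (add p q)
  then show ?case by (simp add: distrib_right fcoef_add)
next
  case (mult p q)
  then show ?case by (simp add: mult.assoc)
qed

text \<open>A continuous \<open>h\<close> with equal end values descends to the circle, where
  Stone-Weierstrass approximates it uniformly by polynomials. These integrate to 0 against
  \<open>f\<close>, and the error is at most e times the L1 norm of \<open>f\<close>.\<close>

lemma integral_zero_mult_periodic_continuous:
  fixes h :: "real \<Rightarrow> real"
  assumes h: "continuous_on {0..1} h" "h 0 = h 1"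
    and f: "integrable circ f" "\<And>n. fcoef f n = 0"
  shows "(\<integral>t. of_real (h t) * f t \<partial>circ) = 0"
proof -
  define H where "H = h \<circ> (\<lambda>z. Arg2pi z / (2 * pi))"
  \<comment> \<open>The loop \<open>h\<close> is homotopic to itself, and the passage from loops to
    circle maps then yields continuity of \<open>H\<close> even at the point 1, where
    \<open>Arg2pi\<close> jumps.\<close>
  have "homotopic_loops UNIV h h"
    using h by (simp add: homotopic_loops_refl path_def pathstart_def pathfinish_def)
  then have contH: "continuous_on (sphere 0 1) H"
    unfolding H_def using homotopic_loops_imp_homotopic_circlemaps homotopic_with_imp_continuous by blast
  have Hzc: "H (zc t) = h t" if "t \<in> {0..1}" for t
  proof (cases "t = 1")
    case True
    have "Arg2pi 1 = 0"
      by (rule Arg2pi_unique[of 1]) auto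
    moreover have "zc 1 = 1"
      by (simp add: zc_def)
    ultimately show ?thesis using True h(2) by (simp add: H_def)
  next
    case False
    have "Arg2pi (zc t) = 2 * pi * t"
      by (rule Arg2pi_unique[of 1]) (use that False in \<open>auto simp: zc_def cis_conv_exp\<close>)
    then show ?thesis by (simp add: H_def)
  qed
  have meas_h: "(\<lambda>t. complex_of_real (h t)) \<in> borel_measurable circ"
  proof -
    have "h \<in> borel_measurable (restrict_space borel {0..1})"
      by (rule borel_measurable_continuous_on_restrict[OF h(1)])
    then have "h \<in> borel_measurable circ"
      unfolding circ_def by (simp cong: measurable_cong_sets sets_restrict_space_cong)
    then show ?thesis by measurable
  qed
  have fm [measurable]: "f \<in> borel_measurable circ"
    using f(1) by auto
  have bound: "cmod (\<integral>t. of_real (h t) * f t \<partial>circ) \<le> e * (\<integral>t. cmod (f t) \<partial>circ)" if e: "e > 0" for e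
  proof -
    obtain p where p: "real_polynomial_function p" "\<And>w. w \<in> sphere 0 1 \<Longrightarrow> \<bar>H w - p w\<bar> < e"
      using Stone_Weierstrass_real_polynomial_function[OF compact_sphere contH e] by blast
    have pf: "integrable circ (\<lambda>t. of_real (p (zc t)) * f t)" "fcoef (\<lambda>t. of_real (p (zc t)) * f t) 0 = 0"
      using fcoef_zero_mult_polynomial[OF p(1) f] by auto
    have close: "\<bar>h t - p (zc t)\<bar> < e" if "t \<in> {0..1}" for t
      using p(2)[of "zc t"] Hzc[OF that] by (simp add: zc_eq_chi)
    have dif: "cmod (of_real (h t) * f t - of_real (p (zc t)) * f t) \<le> e * cmod (f t)" if "t \<in> {0..1}" for t
      using close[OF that]
      by (simp add: left_diff_distrib[symmetric] norm_mult of_real_diff[symmetric] mult_right_mono del: of_real_diff)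
    have di: "integrable circ (\<lambda>t. of_real (h t) * f t - of_real (p (zc t)) * f t)"
    proof (rule Bochner_Integration.integrable_bound)
      show "integrable circ (\<lambda>t. e * cmod (f t))"
        using f(1) by simp
      show "(\<lambda>t. of_real (h t) * f t - of_real (p (zc t)) * f t) \<in> borel_measurable circ"
        using meas_h borel_measurable_integrable[OF pf(1)] by measurable
      show "AE t in circ. cmod (of_real (h t) * f t - of_real (p (zc t)) * f t) \<le> norm (e * cmod (f t))"
        by (rule AE_I2) (use dif \<open>e > 0\<close> in auto)
    qed
    have "(\<integral>t. of_real (h t) * f t \<partial>circ)
        = (\<integral>t. of_real (h t) * f t - of_real (p (zc t)) * f t \<partial>circ) + (\<integral>t. of_real (p (zc t)) * f t \<partial>circ)"
      by (subst Bochner_Integration.integral_add[symmetric, OF di pf(1)]) simp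
    also have "(\<integral>t. of_real (p (zc t)) * f t \<partial>circ) = 0"
      using pf(2) by (simp add: fcoef_eq ip_def)
    finally have "cmod (\<integral>t. of_real (h t) * f t \<partial>circ)
        \<le> (\<integral>t. cmod (of_real (h t) * f t - of_real (p (zc t)) * f t) \<partial>circ)"
      by (simp add: integral_norm_bound)
    also have "\<dots> \<le> (\<integral>t. e * cmod (f t) \<partial>circ)"
      by (rule integral_mono) (use di f(1) dif in auto)
    finally show ?thesis by simp
  qed
  have "cmod (\<integral>t. of_real (h t) * f t \<partial>circ) \<le> 0"
  proof (rule tendsto_lowerbound)
    show "((\<lambda>e. e * (\<integral>t. cmod (f t) \<partial>circ)) \<longlongrightarrow> 0) (at_right 0)"
      by (auto intro!: tendsto_eq_intros)
    show "\<forall>\<^sub>F e in at_right 0. cmod (\<integral>t. of_real (h t) * f t \<partial>circ) \<le> e * (\<integral>t. cmod (f t) \<partial>circ)"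
      unfolding eventually_at_right_field using bound by (auto intro: exI[of _ 1])
  qed simp
  then show ?thesis by simp
qed

lemma AE_circ_open: "AE t in circ. t \<in> {0<..<1}"
proof -
  have "AE t in lborel. t \<in> {0..1::real} \<longrightarrow> t \<in> {0<..<1}"
    using AE_lborel_singleton[of "0::real"] AE_lborel_singleton[of "1::real"]
    by eventually_elim auto
  then show ?thesis
    unfolding circ_def by (subst AE_restrict_space_iff) auto
qed

text \<open>The indicator of an open interval is the pointwise limit of continuous trapezoids
  between 0 and 1; dominated convergence carries the vanishing over.\<close>

lemma integral_zero_on_interval:
  assumes f: "integrable circ f" "\<And>n. fcoef f n = 0"
  shows "(LINT t:{a<..<b}|circ. f t) = 0"
proof -
  \<comment> \<open>Clipping the interval to [0,1] forces every \<open>h n\<close> to vanish at both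
    0 and 1, as periodicity demands. On the open unit interval, hence almost everywhere, the
    indicator is unchanged.\<close>
  define a' b' where "a' = max a 0" and "b' = min b 1"
  define h :: "nat \<Rightarrow> real \<Rightarrow> real" where "h n t = min 1 (real n * max 0 (min (t - a') (b' - t)))" for n t
  have [measurable]: "f \<in> borel_measurable circ"
    using f(1) by auto
  have h0: "(\<integral>t. of_real (h n t) * f t \<partial>circ) = 0" for n
  proof (rule integral_zero_mult_periodic_continuous[OF _ _ f])
    show "continuous_on {0..1} (h n)"
      unfolding h_def by (intro continuous_intros)
    show "h n 0 = h n 1"
    proof -
      have "max 0 (min (0 - a') (b' - 0)) = 0" "max 0 (min (1 - a') (b' - 1)) = 0"
        by (auto simp: a'_def b'_def)
      then show ?thesis by (simp add: h_def)
    qed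
  qed
  have lim: "(\<lambda>n. h n t) \<longlonglongrightarrow> indicator {a'<..<b'} t" for t
  proof (cases "t \<in> {a'<..<b'}")
    case True
    define d where "d = min (t - a') (b' - t)"
    have "d > 0" using True by (simp add: d_def)
    have "\<forall>\<^sub>F n in sequentially. h n t = 1"
    proof -
      obtain N where N: "1 \<le> real N * d"
        using reals_Archimedean3[OF \<open>d > 0\<close>] by (metis less_imp_le)
      have "h n t = 1" if "n \<ge> N" for n
      proof -
        have "real N * d \<le> real n * d"
          using that \<open>d > 0\<close> by (simp add: mult_right_mono)
        then have "1 \<le> real n * max 0 d"
          using order_trans[OF N] \<open>d > 0\<close> by simp
        then show ?thesis unfolding h_def d_def by (rule min.absorb1)
      qed
      then show ?thesis by (auto simp: eventually_sequentially)
    qed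
    then show ?thesis using True by (simp add: tendsto_eventually)
  next
    case False
    then have "max 0 (min (t - a') (b' - t)) = 0" by auto
    then have "h n t = 0" for n
      by (simp add: h_def)
    then show ?thesis using False by simp
  qed
  have "(\<lambda>n. \<integral>t. of_real (h n t) * f t \<partial>circ) \<longlonglongrightarrow> (\<integral>t. of_real (indicator {a'<..<b'} t) * f t \<partial>circ)"
  proof (rule integral_dominated_convergence)
    show "integrable circ (\<lambda>t. cmod (f t))" using f(1) by simp
    have "h n \<in> borel_measurable circ" for n
      by (rule borel_measurable_circI) (simp add: h_def[abs_def])
    then show "(\<lambda>t. of_real (h n t) * f t) \<in> borel_measurable circ" for n by measurable
    have "indicator {a'<..<b'} \<in> borel_measurable circ"
      by (rule borel_measurable_circI) simp
    then show "(\<lambda>t. of_real (indicat_real {a'<..<b'} t) * f t) \<in> borel_measurable circ" by measurable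
    show "AE t in circ. (\<lambda>n. of_real (h n t) * f t) \<longlonglongrightarrow> of_real (indicat_real {a'<..<b'} t) * f t"
      by (intro AE_I2 tendsto_mult tendsto_of_real lim tendsto_const)
    have "\<bar>h n t\<bar> \<le> 1" for n t
      unfolding h_def by (auto simp: min_def max_def)
    then show "AE t in circ. cmod (of_real (h n t) * f t) \<le> cmod (f t)" for n
      by (simp add: norm_mult mult_left_le_one_le)
  qed
  then have "(\<integral>t. of_real (indicator {a'<..<b'} t) * f t \<partial>circ) = 0"
    unfolding h0 by (simp add: LIMSEQ_const_iff)
  moreover have "(LINT t:{a<..<b}|circ. f t) = (\<integral>t. of_real (indicator {a'<..<b'} t) * f t \<partial>circ)"
    unfolding set_lebesgue_integral_def
  proof (rule integral_cong_AE)
    have i: "indicator {x<..<y::real} \<in> borel_measurable circ" for x y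
      by (rule borel_measurable_circI) simp
    show "(\<lambda>t. indicat_real {a<..<b} t *\<^sub>R f t) \<in> borel_measurable circ"
      "(\<lambda>t. of_real (indicat_real {a'<..<b'} t) * f t) \<in> borel_measurable circ"
      using i[of a b] i[of a' b'] by measurable
    show "AE t in circ. indicat_real {a<..<b} t *\<^sub>R f t = of_real (indicat_real {a'<..<b'} t) * f t"
      using AE_circ_open
      by eventually_elim (auto simp: indicator_def a'_def b'_def)
  qed
  ultimately show ?thesis by simp
qed

text \<open>It suffices that the integral of \<open>f\<close> over every measurable set is 0. This
  is a Dynkin argument: the open intervals form an intersection-stable generator of the Borel
  sets.\<close>

theorem fcoef_zero_AE:
  assumes f: "integrable circ f" "\<And>n. fcoef f n = 0"
  shows "AE t in circ. f t = 0"
proof (rule circ.density_zero[OF f(1)])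
  fix A assume A: "A \<in> sets circ"
  have sets_circ: "B \<inter> {0..1} \<in> sets circ" if "B \<in> sets borel" for B
    unfolding circ_def using that by (subst sets_restrict_space_iff) auto
  have sint: "set_integrable circ (B \<inter> {0..1}) f" if "B \<in> sets borel" for B
    unfolding set_integrable_def by (rule integrable_mult_indicator[OF sets_circ[OF that] f(1)])
  \<comment> \<open>The induction runs over Borel sets of the line, whereas sets of
    \<open>circ\<close> lie in [0,1]; intersecting with [0,1] reconciles the two without changing
    integrals.\<close>
  have cut: "(LINT t:(B \<inter> {0..1})|circ. f t) = (LINT t:B|circ. f t)" for B
    unfolding set_lebesgue_integral_def
    by (rule Bochner_Integration.integral_cong) (auto simp: indicator_def)
  define G where "G = range (\<lambda>(a, b). {a<..<b::real})"
  have "(\<lambda>(a, b). box a b :: real set) = (\<lambda>(a, b). {a<..<b})"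
    by (auto simp: fun_eq_iff)
  then have borel: "sets borel = sigma_sets UNIV G"
    unfolding G_def by (subst borel_eq_box) (simp add: sets_measure_of del: box_real)
  have "A \<in> sets borel" and A01: "A \<inter> {0..1} = A"
    using A unfolding circ_def by (auto simp: sets_restrict_space)
  then have Asig: "A \<in> sigma_sets UNIV G"
    using borel by simp
  have Gint: "Int_stable G"
    unfolding G_def Int_stable_def
  proof (intro ballI)
    fix X Y assume "X \<in> range (\<lambda>(a, b). {a<..<b::real})" "Y \<in> range (\<lambda>(a, b). {a<..<b::real})"
    then obtain a b c d where "X = {a<..<b}" "Y = {c<..<d}" by auto
    then have "X \<inter> Y = (\<lambda>(a, b). {a<..<b}) (max a c, min b d)" by auto
    then show "X \<inter> Y \<in> range (\<lambda>(a, b). {a<..<b})" by blast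
  qed
  have "(LINT t:(A \<inter> {0..1})|circ. f t) = 0"
    using Gint subset_UNIV[of G, unfolded Pow_UNIV[symmetric]] Asig
  proof (induction rule: sigma_sets_induct_disjoint)
    case (basic B)
    then show ?case
      using integral_zero_on_interval[OF f] by (auto simp: G_def cut)
  next
    case empty
    then show ?case by (simp add: set_lebesgue_integral_def)
  next
    case (compl B)
    then have B: "B \<in> sets borel" using borel by simp
    have "(LINT t:((UNIV - B) \<inter> {0..1})|circ. f t) + (LINT t:(B \<inter> {0..1})|circ. f t)
        = (LINT t:((UNIV - B) \<inter> {0..1} \<union> B \<inter> {0..1})|circ. f t)"
      by (rule set_integral_Un[symmetric]) (use B in \<open>auto intro!: sint\<close>)
    also have "(UNIV - B) \<inter> {0..1} \<union> B \<inter> {0..1} = UNIV \<inter> {0..1}" by auto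
    \<comment> \<open>The integral over the whole circle is the coefficient of index 0, so
      complements inherit the value 0.\<close>
    also have "(LINT t:UNIV \<inter> {0..1}|circ. f t) = fcoef f 0"
      unfolding cut by (simp add: set_lebesgue_integral_def fcoef_eq ip_def)
    finally show ?case using compl f(2) by simp
  next
    case (union B)
    then have B: "B i \<in> sets borel" for i using borel by auto
    have "(LINT t:(\<Union>i. B i \<inter> {0..1})|circ. f t) = (\<Sum>i. (LINT t:(B i \<inter> {0..1})|circ. f t))"
    proof (rule lebesgue_integral_countable_add)
      show "set_integrable circ (\<Union>i. B i \<inter> {0..1}) f"
        using sint[of "\<Union>i. B i"] B by (auto simp: Int_UN_distrib2)
    qed (use union B sets_circ in \<open>auto simp: disjoint_family_on_def\<close>)
    moreover have "(\<Union>i. B i \<inter> {0..1}) = (\<Union>i. B i) \<inter> {0..1}" by auto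
    ultimately show ?case using union by simp
  qed
  then show "(LINT t:A|circ. f t) = 0"
    unfolding A01 .
qed

subsection \<open>Completeness and Fourier series\<close>

text \<open>Fatou's lemma applied to the squared moduli.\<close>

lemma L2_limit_bound:
  assumes g: "\<And>i. g i \<in> L2" and bnd: "\<And>i. i \<ge> N \<Longrightarrow> L2norm (g i) \<le> e" and "e \<ge> 0"
    and h: "h \<in> borel_measurable circ" and lim: "AE t in circ. (\<lambda>i. g i t) \<longlonglongrightarrow> h t"
  shows "h \<in> L2" "L2norm h \<le> e"
proof -
  have [measurable]: "g i \<in> borel_measurable circ" "h \<in> borel_measurable circ" for i
    using g h by auto
  have nn: "(\<integral>\<^sup>+t. ennreal ((cmod (g i t))\<^sup>2) \<partial>circ) = ennreal ((L2norm (g i))\<^sup>2)" for i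
    unfolding L2norm_sq by (rule nn_integral_eq_integral) (auto intro: L2_integrable_sq g)
  have "(\<integral>\<^sup>+t. ennreal ((cmod (h t))\<^sup>2) \<partial>circ) = (\<integral>\<^sup>+t. liminf (\<lambda>i. ennreal ((cmod (g i t))\<^sup>2)) \<partial>circ)"
  proof (rule nn_integral_cong_AE)
    show "AE t in circ. ennreal ((cmod (h t))\<^sup>2) = liminf (\<lambda>i. ennreal ((cmod (g i t))\<^sup>2))"
      using lim
    proof eventually_elim
      case (elim t)
      then have "(\<lambda>i. ennreal ((cmod (g i t))\<^sup>2)) \<longlonglongrightarrow> ennreal ((cmod (h t))\<^sup>2)"
        by (intro tendsto_intros)
      from lim_imp_Liminf[OF _ this] show ?case by simp
    qed
  qed
  also have "\<dots> \<le> liminf (\<lambda>i. \<integral>\<^sup>+t. ennreal ((cmod (g i t))\<^sup>2) \<partial>circ)"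
    by (rule nn_integral_liminf) measurable
  also have "\<dots> \<le> liminf (\<lambda>i. ennreal (e\<^sup>2))"
    unfolding nn
    by (rule Liminf_mono) (auto simp: eventually_sequentially intro!: exI[of _ N] ennreal_leI power_mono bnd)
  finally have le: "(\<integral>\<^sup>+t. ennreal ((cmod (h t))\<^sup>2) \<partial>circ) \<le> ennreal (e\<^sup>2)"
    by (simp add: Liminf_const)
  have int: "integrable circ (\<lambda>t. (cmod (h t))\<^sup>2)"
    by (rule integrableI_bounded) (use le in \<open>auto intro: le_less_trans\<close>)
  then show "h \<in> L2" by (simp add: L2_def)
  have "ennreal ((L2norm h)\<^sup>2) \<le> ennreal (e\<^sup>2)"
    using le nn_integral_eq_integral[OF int] by (simp add: L2norm_sq)
  then have "(L2norm h)\<^sup>2 \<le> e\<^sup>2" by (simp add: ennreal_le_iff)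
  then show "L2norm h \<le> e"
    using \<open>e \<ge> 0\<close> by (rule power2_le_imp_le)
qed

text \<open>An L2 Cauchy sequence is Cauchy in L1, so some subsequence converges almost everywhere.
  Fixing n and letting i grow in s n - s (r i), the Fatou bound gives membership in L2 and
  convergence in norm at once.\<close>

theorem L2_complete:
  assumes s: "\<And>n. s n \<in> L2"
    and C: "\<And>e. e > 0 \<Longrightarrow> \<exists>N. \<forall>m\<ge>N. \<forall>n\<ge>N. L2norm (\<lambda>t. s m t - s n t) < e"
  shows "\<exists>f\<in>L2. (\<lambda>n. L2norm (\<lambda>t. s n t - f t)) \<longlonglongrightarrow> 0"
proof -
  have "\<exists>N. \<forall>i\<ge>N. \<forall>j\<ge>N. (\<integral>t. cmod (s i t - s j t) \<partial>circ) < e" if "e > 0" for e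
    using C[OF that] L1_le_L2norm[OF L2_diff[OF s s]] by (meson le_less_trans)
  from cauchy_L1_AE_cauchy_subseq[OF L2_integrable[OF s] this]
  obtain r where r: "strict_mono r" "AE t in circ. Cauchy (\<lambda>i. s (r i) t)" by blast
  define f where "f t = lim (\<lambda>i. s (r i) t)" for t
  have [measurable]: "s n \<in> borel_measurable circ" for n
    using s by auto
  have fm [measurable]: "f \<in> borel_measurable circ"
    unfolding f_def by (rule borel_measurable_lim_metric) simp
  have lim: "AE t in circ. (\<lambda>i. s (r i) t) \<longlonglongrightarrow> f t"
    using r(2) by eventually_elim (simp add: f_def Cauchy_convergent_iff convergent_LIMSEQ_iff)
  have key: "(\<lambda>t. s n t - f t) \<in> L2 \<and> L2norm (\<lambda>t. s n t - f t) \<le> e"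
    if "e > 0" "\<forall>m\<ge>N. \<forall>n\<ge>N. L2norm (\<lambda>t. s m t - s n t) < e" "n \<ge> N" for e N n
  proof -
    have "L2norm (\<lambda>t. s n t - s (r i) t) \<le> e" if "i \<ge> N" for i
    proof -
      have "r i \<ge> N"
        using seq_suble[OF r(1), of i] that by simp
      then show ?thesis using \<open>\<forall>m\<ge>N. _\<close> \<open>n \<ge> N\<close> by (simp add: less_imp_le)
    qed
    moreover have "AE t in circ. (\<lambda>i. s n t - s (r i) t) \<longlonglongrightarrow> s n t - f t"
      using lim by eventually_elim (intro tendsto_intros)
    ultimately show ?thesis
      using L2_limit_bound[of "\<lambda>i t. s n t - s (r i) t" N e "\<lambda>t. s n t - f t"] \<open>e > 0\<close> s
      by (auto simp: L2_diff)
  qed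
  obtain N where "\<forall>m\<ge>N. \<forall>n\<ge>N. L2norm (\<lambda>t. s m t - s n t) < 1"
    using C[of 1] by auto
  then have "(\<lambda>t. s N t - f t) \<in> L2"
    using key[of 1 N N] by simp
  \<comment> \<open>The limit is recovered as f = s N - (s N - f).\<close>
  from L2_diff[OF s[of N] this] have fL2: "f \<in> L2" by simp
  have "(\<lambda>n. L2norm (\<lambda>t. s n t - f t)) \<longlonglongrightarrow> 0"
  proof (rule LIMSEQ_I)
    fix e :: real assume "e > 0"
    then obtain N where "\<forall>m\<ge>N. \<forall>n\<ge>N. L2norm (\<lambda>t. s m t - s n t) < e / 2"
      using C[of "e / 2"] by auto
    then have "\<forall>n\<ge>N. L2norm (\<lambda>t. s n t - f t) \<le> e / 2"
      using key[of "e / 2" N] \<open>e > 0\<close> by auto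
    then show "\<exists>N. \<forall>n\<ge>N. norm (L2norm (\<lambda>t. s n t - f t) - 0) < e"
      using \<open>e > 0\<close> by (intro exI[of _ N]) force
  qed
  with fL2 show ?thesis by blast
qed

section \<open>Trigonometric sums, the Riesz-Fischer theorem and Fourier series\<close>

definition psum :: "(int \<Rightarrow> complex) \<Rightarrow> nat \<Rightarrow> real \<Rightarrow> complex" where
  "psum a n t = (\<Sum>k\<in>{- int n..int n}. a k * chi k t)"

lemma trig_L2: "(\<lambda>t. \<Sum>k\<in>F. a k * chi k t) \<in> L2"
  by (intro L2_sum L2_cmult chi_L2)

lemma psum_L2 [simp]: "psum a n \<in> L2"
  unfolding psum_def[abs_def] by (rule trig_L2)

lemma fcoef_trig: "finite F \<Longrightarrow> fcoef (\<lambda>t. \<Sum>k\<in>F. a k * chi k t) j = (if j \<in> F then a j else 0)"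
  by (simp add: fcoef_eq ip_sum_left ip_chi_chi if_distrib[of "\<lambda>x. _ * x"] cong: if_cong)

lemma L2norm_trig:
  assumes "finite F"
  shows "(L2norm (\<lambda>t. \<Sum>k\<in>F. a k * chi k t))\<^sup>2 = (\<Sum>k\<in>F. (cmod (a k))\<^sup>2)"
proof -
  let ?S = "\<lambda>t. \<Sum>k\<in>F. a k * chi k t"
  have "complex_of_real ((L2norm ?S)\<^sup>2) = (\<Sum>k\<in>F. cnj (a k) * fcoef ?S k)"
    unfolding ip_self[symmetric] fcoef_eq by (rule ip_sum_right) (auto simp: trig_L2)
  also have "\<dots> = (\<Sum>k\<in>F. of_real ((cmod (a k))\<^sup>2))"
    by (rule sum.cong) (simp_all only: fcoef_trig[OF assms] complex_norm_square if_True mult.commute)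
  finally show ?thesis
    by (simp only: of_real_sum[symmetric] of_real_eq_iff)
qed

text \<open>By orthogonality the squared distance of two partial sums is the difference of two terms
  of the bounded increasing sequence \<open>T\<close>, so completeness applies. The norm convergence
  is part of the conclusion because the Fejer means are built from the same partial sums.\<close>

theorem Riesz_Fischer:
  assumes B: "\<And>n::nat. (\<Sum>k\<in>{- int n..int n}. (cmod (a k))\<^sup>2) \<le> B"
  shows "\<exists>\<phi>\<in>L2. (\<forall>k. fcoef \<phi> k = a k) \<and> (\<lambda>n. L2norm (\<lambda>t. psum a n t - \<phi> t)) \<longlonglongrightarrow> 0"
proof -
  define T where "T n = (\<Sum>k\<in>{- int n..int n}. (cmod (a k))\<^sup>2)" for n :: nat
  have "incseq T"
    unfolding T_def by (intro incseq_SucI sum_mono2) auto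
  then have "convergent T"
    using B by (intro Bseq_mono_convergent) (auto intro!: BseqI'[of _ B] simp: T_def mono_def sum_nonneg)
  then have Cau: "Cauchy T" by (rule convergent_Cauchy)
  have dif: "(L2norm (\<lambda>t. psum a n t - psum a m t))\<^sup>2 = \<bar>T n - T m\<bar>" if "m \<le> n" for m n
  proof -
    have sub: "{- int m..int m} \<subseteq> {- int n..int n}" using that by auto
    have "(\<lambda>t. psum a n t - psum a m t) = (\<lambda>t. \<Sum>k\<in>{- int n..int n} - {- int m..int m}. a k * chi k t)"
      unfolding psum_def by (simp add: sum_diff[OF _ sub])
    then have "(L2norm (\<lambda>t. psum a n t - psum a m t))\<^sup>2 = (\<Sum>k\<in>{- int n..int n} - {- int m..int m}. (cmod (a k))\<^sup>2)"
      by (simp only: L2norm_trig finite_Diff finite_atLeastAtMost_int)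
    also have "\<dots> = T n - T m"
      unfolding T_def by (rule sum_diff[OF _ sub]) simp
    finally have "(L2norm (\<lambda>t. psum a n t - psum a m t))\<^sup>2 = T n - T m" .
    moreover have "T n - T m \<ge> 0" using \<open>incseq T\<close> that by (simp add: mono_def)
    ultimately show ?thesis by simp
  qed
  have dif': "(L2norm (\<lambda>t. psum a n t - psum a m t))\<^sup>2 = \<bar>T n - T m\<bar>" for m n
    using dif[of m n] dif[of n m] L2norm_minus_commute[of "psum a n" "psum a m"]
    by (cases "m \<le> n") (simp_all add: abs_minus_commute)
  have "\<exists>N. \<forall>m\<ge>N. \<forall>n\<ge>N. L2norm (\<lambda>t. psum a m t - psum a n t) < e" if "e > 0" for e
  proof -
    obtain N where N: "\<forall>m\<ge>N. \<forall>n\<ge>N. \<bar>T m - T n\<bar> < e\<^sup>2"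
      using metric_CauchyD[OF Cau, of "e\<^sup>2"] \<open>e > 0\<close> by (auto simp: dist_real_def)
    have "L2norm (\<lambda>t. psum a m t - psum a n t) < e" if "m \<ge> N" "n \<ge> N" for m n
      using N that \<open>e > 0\<close> by (intro power2_less_imp_less[of _ e]) (auto simp: dif')
    then show ?thesis by blast
  qed
  from L2_complete[OF psum_L2 this]
  obtain \<phi> where \<phi>: "\<phi> \<in> L2" "(\<lambda>n. L2norm (\<lambda>t. psum a n t - \<phi> t)) \<longlonglongrightarrow> 0" by blast
  have "fcoef \<phi> k = a k" for k
  proof -
    have "(\<lambda>n. ip (psum a n) (chi k)) \<longlonglongrightarrow> ip \<phi> (chi k)"
      by (rule ip_tendsto_left[OF psum_L2 \<phi>(1) chi_L2 \<phi>(2)])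
    moreover have "\<forall>\<^sub>F n in sequentially. ip (psum a n) (chi k) = a k"
      unfolding eventually_sequentially
    proof (intro exI allI impI)
      fix n assume "n \<ge> nat \<bar>k\<bar>"
      then have "k \<in> {- int n..int n}" by auto
      then show "ip (psum a n) (chi k) = a k"
        unfolding psum_def[abs_def] fcoef_eq[symmetric] by (simp add: fcoef_trig)
    qed
    then have "(\<lambda>n. ip (psum a n) (chi k)) \<longlonglongrightarrow> a k"
      by (rule tendsto_eventually)
    ultimately show ?thesis
      unfolding fcoef_eq by (rule LIMSEQ_unique)
  qed
  with \<phi> show ?thesis by blast
qed

lemma fcoef_diff: "\<lbrakk>f \<in> L2; g \<in> L2\<rbrakk> \<Longrightarrow> fcoef (\<lambda>t. f t - g t) n = fcoef f n - fcoef g n"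
  by (simp add: fcoef_eq ip_diff_left)

lemma AE_eq_of_fcoef_eq:
  assumes "f \<in> L2" "g \<in> L2" "\<And>k. fcoef f k = fcoef g k"
  shows "AE t in circ. f t = g t"
proof -
  have "AE t in circ. f t - g t = 0"
    by (rule fcoef_zero_AE) (use assms in \<open>auto intro: L2_integrable L2_diff simp: fcoef_diff\<close>)
  then show ?thesis by simp
qed

text \<open>For the partial sum S one has ip f S = norm(S)^2, so Cauchy-Schwarz gives norm(S) at
  most norm(f).\<close>

lemma Bessel:
  assumes f: "f \<in> L2" and F: "finite F"
  shows "(\<Sum>k\<in>F. (cmod (fcoef f k))\<^sup>2) \<le> (L2norm f)\<^sup>2"
proof -
  define S where "S t = (\<Sum>k\<in>F. fcoef f k * chi k t)" for t
  have S: "S \<in> L2" unfolding S_def[abs_def] by (rule trig_L2)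
  have nS: "(L2norm S)\<^sup>2 = (\<Sum>k\<in>F. (cmod (fcoef f k))\<^sup>2)"
    unfolding S_def[abs_def] by (rule L2norm_trig[OF F])
  have "ip f S = (\<Sum>k\<in>F. cnj (fcoef f k) * fcoef f k)"
    unfolding S_def[abs_def] fcoef_eq by (rule ip_sum_right) (auto simp: f)
  also have "\<dots> = of_real ((L2norm S)\<^sup>2)"
    unfolding nS of_real_sum complex_norm_square by (simp add: mult.commute)
  finally have "(L2norm S)\<^sup>2 \<le> L2norm f * L2norm S"
    using ip_Cauchy_Schwarz[OF f S] by (simp del: of_real_power)
  then have "L2norm S \<le> L2norm f"
    by (cases "L2norm S = 0") (auto simp: power2_eq_square less_le)
  then show ?thesis
    unfolding nS[symmetric] by (intro power_mono) auto
qed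

text \<open>Bessel and Riesz-Fischer produce a limit of the partial sums with the same coefficients
  as \<open>f\<close>; uniqueness of coefficients identifies it with \<open>f\<close>.\<close>

theorem Fourier_series_L2:
  assumes f: "f \<in> L2"
  shows "(\<lambda>n. L2norm (\<lambda>t. psum (fcoef f) n t - f t)) \<longlonglongrightarrow> 0"
proof -
  obtain \<phi> where \<phi>: "\<phi> \<in> L2" "\<And>k. fcoef \<phi> k = fcoef f k"
      "(\<lambda>n. L2norm (\<lambda>t. psum (fcoef f) n t - \<phi> t)) \<longlonglongrightarrow> 0"
    using Riesz_Fischer[OF Bessel[OF f]] by auto
  have "AE t in circ. \<phi> t = f t"
    using \<phi>(1) f \<phi>(2) by (rule AE_eq_of_fcoef_eq)
  then have "L2norm (\<lambda>t. psum (fcoef f) n t - \<phi> t) = L2norm (\<lambda>t. psum (fcoef f) n t - f t)" for n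
    by (intro L2norm_cong_AE L2_diff psum_L2 f \<phi>(1)) (auto elim: eventually_mono)
  with \<phi>(3) show ?thesis by simp
qed

text \<open>A special case of Parseval's identity, obtained by letting the partial sums of
  \<open>f\<close> converge. It supplies the orthogonality of analytic and antianalytic parts
  below.\<close>

lemma ip_zero_of_disjoint_spectrum:
  assumes f: "f \<in> L2" and g: "g \<in> L2" and z: "\<And>k. fcoef f k = 0 \<or> fcoef g k = 0"
  shows "ip f g = 0"
proof -
  have "ip (psum (fcoef f) n) g = 0" for n
  proof -
    have "ip (psum (fcoef f) n) g = (\<Sum>k\<in>{- int n..int n}. fcoef f k * ip (chi k) g)"
      unfolding psum_def[abs_def] by (rule ip_sum_left) (auto simp: g)
    also have "\<dots> = (\<Sum>k\<in>{- int n..int n}. fcoef f k * cnj (fcoef g k))"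
      by (simp add: fcoef_eq ip_cnj)
    also have "\<dots> = 0"
      by (rule sum.neutral) (use z in auto)
    finally show ?thesis .
  qed
  then show ?thesis
    using ip_tendsto_left[OF psum_L2 f g Fourier_series_L2[OF f]] by (simp add: LIMSEQ_const_iff)
qed

subsection \<open>The Hardy space and model spaces\<close>

lemma fcoef_cnj: "fcoef (\<lambda>t. cnj (f t)) k = cnj (fcoef f (- k))"
proof -
  have "cnj (fcoef f (- k)) = (\<integral>t. cnj (f t * cnj (chi (- k) t)) \<partial>circ)"
    unfolding fcoef_eq ip_def by (rule Bochner_Integration.integral_cnj[symmetric])
  then show ?thesis by (simp add: fcoef_eq ip_def cnj_chi)
qed

lemma ip_mult_left: "ip (\<lambda>t. a t * f t) g = ip f (\<lambda>t. cnj (a t) * g t)"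
  unfolding ip_def by (simp add: mult_ac)

lemma H2_L2: "f \<in> H2 \<Longrightarrow> f \<in> L2"
  by (simp add: H2_def)

lemma H2_fcoef: "f \<in> H2 \<Longrightarrow> n < 0 \<Longrightarrow> fcoef f n = 0"
  by (simp add: H2_def)

lemma H2_diff: "f \<in> H2 \<Longrightarrow> g \<in> H2 \<Longrightarrow> (\<lambda>t. f t - g t) \<in> H2"
  by (auto simp: H2_def L2_diff fcoef_diff)

lemma H2_add: "f \<in> H2 \<Longrightarrow> g \<in> H2 \<Longrightarrow> (\<lambda>t. f t + g t) \<in> H2"
  by (auto simp: H2_def L2_add fcoef_eq ip_add_left)

lemma H2_cmult: "f \<in> H2 \<Longrightarrow> (\<lambda>t. c * f t) \<in> H2"
  by (auto simp: H2_def L2_cmult fcoef_eq ip_cmult_left)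

lemma H2_zero: "(\<lambda>t. 0) \<in> H2"
  by (auto simp: H2_def zero_L2 fcoef_eq ip_def)

lemma H2_sum: "(\<And>i. i \<in> I \<Longrightarrow> h i \<in> H2) \<Longrightarrow> (\<lambda>t. \<Sum>i\<in>I. h i t) \<in> H2"
  by (induction I rule: infinite_finite_induct) (auto simp: H2_zero H2_add)

lemma chi_H2: "n \<ge> 0 \<Longrightarrow> chi n \<in> H2"
  by (auto simp: H2_def fcoef_eq ip_chi_chi)

text \<open>Coefficient n of the product is the inner product of g with z^n cnj \<alpha>. For n < 0
  the latter has only negative frequencies, while g has none.\<close>

lemma H2_mult:
  assumes "\<alpha> \<in> Linf" "\<alpha> \<in> H2" "g \<in> H2"
  shows "(\<lambda>t. \<alpha> t * g t) \<in> H2"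
proof -
  have "fcoef (\<lambda>t. \<alpha> t * g t) n = 0" if "n < 0" for n
  proof -
    have "fcoef (\<lambda>t. \<alpha> t * g t) n = ip g (\<lambda>t. chi n t * cnj (\<alpha> t))"
      unfolding fcoef_eq ip_mult_left by (simp add: mult.commute)
    also have "\<dots> = 0"
    proof (rule ip_zero_of_disjoint_spectrum)
      show "g \<in> L2" using assms by (simp add: H2_L2)
      show "(\<lambda>t. chi n t * cnj (\<alpha> t)) \<in> L2"
        by (intro Linf_mult_L2 chi_Linf L2_cnj H2_L2 assms)
      show "fcoef g k = 0 \<or> fcoef (\<lambda>t. chi n t * cnj (\<alpha> t)) k = 0" for k
        using that assms(2,3) by (cases "k < 0") (auto simp: H2_fcoef fcoef_chi_mult fcoef_cnj)
    qed
    finally show ?thesis .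
  qed
  then show ?thesis using assms by (auto simp: H2_def intro: Linf_mult_L2)
qed

text \<open>\<open>proj\<close> picks its value by choice, so its characteristic properties become
  available once some candidate has been exhibited.\<close>

lemma proj_works:
  assumes "\<exists>g\<in>S. \<forall>k\<in>S. ip (\<lambda>t. h t - g t) k = 0"
  shows "proj S h \<in> S" "\<And>k. k \<in> S \<Longrightarrow> ip (\<lambda>t. h t - proj S h t) k = 0"
  using someI_ex[of "\<lambda>g. g \<in> S \<and> (\<forall>k\<in>S. ip (\<lambda>t. h t - g t) k = 0)"] assms
  unfolding proj_def by auto

text \<open>The candidate is the function whose coefficients are those of \<open>h\<close> cut off
  below 0; it exists by Bessel and Riesz-Fischer. What is removed has only negative
  frequencies.\<close>

lemma P_works:
  assumes h: "h \<in> L2"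
  shows "P h \<in> H2" "\<And>k. k \<in> H2 \<Longrightarrow> ip (P h) k = ip h k"
proof -
  define a where "a k = (if k \<ge> 0 then fcoef h k else 0)" for k
  have "(\<Sum>k\<in>{- int n..int n}. (cmod (a k))\<^sup>2) \<le> (L2norm h)\<^sup>2" for n
  proof -
    have "(\<Sum>k\<in>{- int n..int n}. (cmod (a k))\<^sup>2) \<le> (\<Sum>k\<in>{- int n..int n}. (cmod (fcoef h k))\<^sup>2)"
      by (rule sum_mono) (simp add: a_def)
    also have "\<dots> \<le> (L2norm h)\<^sup>2" by (rule Bessel[OF h]) simp
    finally show ?thesis .
  qed
  from Riesz_Fischer[OF this] obtain g where g: "g \<in> L2" "\<And>k. fcoef g k = a k"
    by blast
  have "g \<in> H2" using g by (auto simp: H2_def a_def)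
  moreover have "ip (\<lambda>t. h t - g t) k = 0" if "k \<in> H2" for k
  proof (rule ip_zero_of_disjoint_spectrum)
    show "fcoef (\<lambda>t. h t - g t) j = 0 \<or> fcoef k j = 0" for j
      using g h that by (cases "j < 0") (auto simp: H2_fcoef fcoef_diff a_def)
  qed (use that h g in \<open>auto intro: L2_diff H2_L2\<close>)
  ultimately have "\<exists>g\<in>H2. \<forall>k\<in>H2. ip (\<lambda>t. h t - g t) k = 0" by blast
  note * = proj_works[OF this]
  show "P h \<in> H2" unfolding P_def by (rule *(1))
  then show "ip (P h) k = ip h k" if "k \<in> H2" for k
    using *(2)[OF that] that h by (simp add: P_def ip_diff_left H2_L2)
qed

section \<open>Model spaces, their projections and conjugations\<close>

lemma K2_H2: "f \<in> K2 \<alpha> \<Longrightarrow> f \<in> H2"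
  by (simp add: K2_def)

lemma K2_L2: "f \<in> K2 \<alpha> \<Longrightarrow> f \<in> L2"
  by (simp add: K2_H2 H2_L2)

lemma inner_mult_cnj: "inner_fun \<alpha> \<Longrightarrow> AE t in circ. \<alpha> t * cnj (\<alpha> t) = 1"
  unfolding inner_fun_def complex_norm_square[symmetric] by auto

lemma inner_mult_H2: "inner_fun \<alpha> \<Longrightarrow> g \<in> H2 \<Longrightarrow> (\<lambda>t. \<alpha> t * g t) \<in> H2"
  unfolding inner_fun_def by (blast intro: H2_mult)

text \<open>The projection onto the model space is \<open>h \<mapsto> P h - \<alpha> P(cnj \<alpha> \<cdot> P h)\<close>.\<close>

lemma P_alpha_works:
  assumes \<alpha>: "inner_fun \<alpha>" and h: "h \<in> L2"
  shows "P_alpha \<alpha> h \<in> K2 \<alpha>" "\<And>k. k \<in> K2 \<alpha> \<Longrightarrow> ip (P_alpha \<alpha> h) k = ip h k"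
proof -
  define u where "u = P h"
  define v where "v = P (\<lambda>t. cnj (\<alpha> t) * u t)"
  define g where "g t = u t - \<alpha> t * v t" for t
  have \<alpha>L: "\<alpha> \<in> Linf" using \<alpha> by (simp add: inner_fun_def)
  have u: "u \<in> H2" unfolding u_def by (rule P_works[OF h])
  have cu: "(\<lambda>t. cnj (\<alpha> t) * u t) \<in> L2"
    by (intro Linf_mult_L2 cnj_Linf \<alpha>L H2_L2 u)
  have v: "v \<in> H2" unfolding v_def by (rule P_works[OF cu])
  have av: "(\<lambda>t. \<alpha> t * v t) \<in> H2" by (rule inner_mult_H2[OF \<alpha> v])
  have gH: "g \<in> H2" unfolding g_def[abs_def] by (rule H2_diff[OF u av])
  \<comment> \<open>Multiplication by \<alpha> is isometric, so subtracting \<alpha> v removes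
    exactly the component of u in \<alpha> H2.\<close>
  have "ip g (\<lambda>t. \<alpha> t * k t) = 0" if k: "k \<in> H2" for k
  proof -
    have ak: "(\<lambda>t. \<alpha> t * k t) \<in> L2" using inner_mult_H2[OF \<alpha> k] by (rule H2_L2)
    have "ip u (\<lambda>t. \<alpha> t * k t) = ip (\<lambda>t. cnj (\<alpha> t) * u t) k"
      by (simp add: ip_mult_left)
    also have "\<dots> = ip v k" unfolding v_def by (rule P_works(2)[OF cu k, symmetric])
    also have "\<dots> = ip (\<lambda>t. \<alpha> t * v t) (\<lambda>t. \<alpha> t * k t)"
    proof (rule ip_cong_AE)
      show "AE t in circ. v t * cnj (k t) = \<alpha> t * v t * cnj (\<alpha> t * k t)"
        using inner_mult_cnj[OF \<alpha>]
      proof eventually_elim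
        case (elim t)
        have "\<alpha> t * v t * cnj (\<alpha> t * k t) = (\<alpha> t * cnj (\<alpha> t)) * (v t * cnj (k t))" by simp
        with elim show ?case by simp
      qed
    qed (use v k av ak in \<open>auto intro: H2_L2\<close>)
    finally show ?thesis
      unfolding g_def[abs_def] by (simp add: ip_diff_left H2_L2 u av ak)
  qed
  with gH have gK: "g \<in> K2 \<alpha>" by (simp add: K2_def)
  have "ip (\<lambda>t. h t - g t) k = 0" if k: "k \<in> K2 \<alpha>" for k
  proof -
    have "ip k (\<lambda>t. \<alpha> t * v t) = 0" using k v by (simp add: K2_def)
    then have "ip (\<lambda>t. \<alpha> t * v t) k = 0" using ip_cnj[of k "\<lambda>t. \<alpha> t * v t"] by simp
    moreover have "ip u k = ip h k" unfolding u_def by (rule P_works(2)[OF h K2_H2[OF k]])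
    moreover have "ip g k = ip u k - ip (\<lambda>t. \<alpha> t * v t) k"
      unfolding g_def[abs_def] by (simp add: ip_diff_left H2_L2 u av K2_L2[OF k])
    ultimately show ?thesis by (simp add: ip_diff_left h H2_L2 gH K2_L2[OF k])
  qed
  with gK have "\<exists>g\<in>K2 \<alpha>. \<forall>k\<in>K2 \<alpha>. ip (\<lambda>t. h t - g t) k = 0" by blast
  note * = proj_works[OF this]
  show "P_alpha \<alpha> h \<in> K2 \<alpha>" unfolding P_alpha_def by (rule *(1))
  then show "ip (P_alpha \<alpha> h) k = ip h k" if "k \<in> K2 \<alpha>" for k
    using *(2)[OF that] that h by (simp add: P_alpha_def ip_diff_left K2_L2)
qed

text \<open>The conjugation exchanges the two conditions defining the model space: orthogonality of
  \<open>f\<close> to \<alpha> H2 puts the image in H2, and analyticity of \<open>f\<close> makes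
  the image orthogonal to \<alpha> H2.\<close>

lemma C_alpha_K2:
  assumes \<alpha>: "inner_fun \<alpha>" and f: "f \<in> K2 \<alpha>"
  shows "C_alpha \<alpha> f \<in> K2 \<alpha>"
proof -
  have \<alpha>L: "\<alpha> \<in> Linf" using \<alpha> by (simp add: inner_fun_def)
  have CL: "C_alpha \<alpha> f \<in> L2"
    unfolding C_alpha_def complex_cnj_mult zc_eq_chi
    by (intro Linf_mult_L2 \<alpha>L cnj_Linf chi_Linf L2_cnj K2_L2[OF f])
  have "fcoef (C_alpha \<alpha> f) n = 0" if "n < 0" for n
  proof -
    \<comment> \<open>For n < 0 the exponent - n - 1 is nonnegative; the extra - 1 comes from the
      factor cnj z in the conjugation.\<close>
    have "fcoef (C_alpha \<alpha> f) n = ip (\<lambda>t. \<alpha> t * chi (- n - 1) t) f"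
    proof -
      have "C_alpha \<alpha> f t * cnj (chi n t) = \<alpha> t * chi (- n - 1) t * cnj (f t)" for t
        using chi_mult[of "- n" t "- 1"] by (simp add: C_alpha_def zc_eq_chi cnj_chi mult_ac)
      then show ?thesis unfolding fcoef_eq ip_def by (simp only:)
    qed
    also have "\<dots> = cnj (ip f (\<lambda>t. \<alpha> t * chi (- n - 1) t))"
      by (rule ip_cnj[symmetric])
    also have "ip f (\<lambda>t. \<alpha> t * chi (- n - 1) t) = 0"
      using f chi_H2[of "- n - 1"] that by (simp add: K2_def)
    finally show ?thesis by simp
  qed
  with CL have CH: "C_alpha \<alpha> f \<in> H2" by (simp add: H2_def)
  moreover have "ip (C_alpha \<alpha> f) (\<lambda>t. \<alpha> t * g t) = 0" if g: "g \<in> H2" for g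
  proof -
    have ag: "(\<lambda>t. \<alpha> t * g t) \<in> L2" using inner_mult_H2[OF \<alpha> g] by (rule H2_L2)
    have cg: "(\<lambda>t. chi (- 1) t * cnj (g t)) \<in> L2"
      by (intro Linf_mult_L2 chi_Linf L2_cnj H2_L2 g)
    have "ip (C_alpha \<alpha> f) (\<lambda>t. \<alpha> t * g t) = ip (\<lambda>t. chi (- 1) t * cnj (g t)) f"
    proof (rule ip_cong_AE)
      show "AE t in circ. C_alpha \<alpha> f t * cnj (\<alpha> t * g t) = chi (- 1) t * cnj (g t) * cnj (f t)"
        using inner_mult_cnj[OF \<alpha>]
      proof eventually_elim
        case (elim t)
        have "C_alpha \<alpha> f t * cnj (\<alpha> t * g t) = (\<alpha> t * cnj (\<alpha> t)) * (chi (- 1) t * cnj (g t) * cnj (f t))"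
          by (simp add: C_alpha_def zc_eq_chi cnj_chi)
        with elim show ?case by simp
      qed
    qed (use CL ag cg K2_L2[OF f] in auto)
    also have "\<dots> = 0"
    proof (rule ip_zero_of_disjoint_spectrum[OF cg K2_L2[OF f]])
      show "fcoef (\<lambda>t. chi (- 1) t * cnj (g t)) k = 0 \<or> fcoef f k = 0" for k
        using g K2_H2[OF f] by (cases "k < 0") (auto simp: H2_fcoef fcoef_chi_mult fcoef_cnj)
    qed
    finally show ?thesis .
  qed
  ultimately show ?thesis by (simp add: K2_def)
qed

text \<open>Pairing with elements of the model space makes the projections disappear, and the
  symmetry \<open>swap\<close> moves the outer conjugation to the other argument. What remains is an
  identity for the form of \<open>A\<close> alone, used in both directions of the
  equivalence.\<close>

lemma conj_symm_iff:
  assumes \<alpha>: "inner_fun \<alpha>" and A: "\<And>f. f \<in> H2 \<Longrightarrow> A f \<in> H2"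
  shows "conj_symm A \<alpha> \<longleftrightarrow>
    (\<forall>f\<in>K2 \<alpha>. \<forall>g\<in>K2 \<alpha>. ip (A (C_alpha \<alpha> f)) (C_alpha \<alpha> g) = ip (A g) f)"
proof -
  have AL: "A f \<in> L2" if "f \<in> K2 \<alpha>" for f
    using A[OF K2_H2[OF that]] by (rule H2_L2)
  have compr: "compr A \<alpha> f \<in> K2 \<alpha>" "\<And>k. k \<in> K2 \<alpha> \<Longrightarrow> ip (compr A \<alpha> f) k = ip (A f) k"
    if "f \<in> K2 \<alpha>" for f
    unfolding compr_def by (rule P_alpha_works[OF \<alpha> AL[OF that]])+
  have swap: "ip (C_alpha \<alpha> u) g = ip (C_alpha \<alpha> g) u" for u g
    unfolding ip_def C_alpha_def by (simp add: mult_ac)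
  have lhs: "ip (C_alpha \<alpha> (compr A \<alpha> (C_alpha \<alpha> f))) g = cnj (ip (A (C_alpha \<alpha> f)) (C_alpha \<alpha> g))"
    if "f \<in> K2 \<alpha>" "g \<in> K2 \<alpha>" for f g
  proof -
    have "ip (C_alpha \<alpha> (compr A \<alpha> (C_alpha \<alpha> f))) g = cnj (ip (compr A \<alpha> (C_alpha \<alpha> f)) (C_alpha \<alpha> g))"
      unfolding ip_cnj by (rule swap)
    then show ?thesis using that by (simp add: compr C_alpha_K2[OF \<alpha>])
  qed
  have rhs: "ip f (compr A \<alpha> g) = cnj (ip (A g) f)" if "f \<in> K2 \<alpha>" "g \<in> K2 \<alpha>" for f g
    using compr(2)[OF that(2,1)] ip_cnj[of "compr A \<alpha> g" f] by simp
  show ?thesis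
    unfolding conj_symm_def is_adjoint_on_def
    by (auto simp: lhs rhs compr C_alpha_K2[OF \<alpha>] complex_cnj_cancel_iff)
qed

lemma toeplitz_conj_symm:
  assumes A: "\<And>f. f \<in> H2 \<Longrightarrow> A f \<in> H2" and \<phi>: "\<phi> \<in> Linf"
    and eq: "\<And>f. f \<in> H2 \<Longrightarrow> AE t in circ. A f t = toeplitz \<phi> f t"
    and \<alpha>: "inner_fun \<alpha>"
  shows "conj_symm A \<alpha>"
proof -
  \<comment> \<open>Against functions of H2 the projection in the Toeplitz operator drops out,
    leaving multiplication by the symbol.\<close>
  have ipA: "ip (A f) g = ip (\<lambda>t. \<phi> t * f t) g" if f: "f \<in> H2" and g: "g \<in> H2" for f g
  proof -
    have \<phi>f: "(\<lambda>t. \<phi> t * f t) \<in> L2" by (intro Linf_mult_L2 \<phi> H2_L2 f)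
    have "toeplitz \<phi> f \<in> H2" unfolding toeplitz_def by (rule P_works[OF \<phi>f])
    then have "ip (A f) g = ip (toeplitz \<phi> f) g"
      using f g A eq[OF f] by (intro ip_cong_AE) (auto intro: H2_L2)
    also have "\<dots> = ip (\<lambda>t. \<phi> t * f t) g"
      unfolding toeplitz_def by (rule P_works(2)[OF \<phi>f g])
    finally show ?thesis .
  qed
  have "ip (A (C_alpha \<alpha> f)) (C_alpha \<alpha> g) = ip (A g) f" if f: "f \<in> K2 \<alpha>" and g: "g \<in> K2 \<alpha>" for f g
  proof -
    have C: "C_alpha \<alpha> f \<in> H2" "C_alpha \<alpha> g \<in> H2"
      using f g by (auto intro: K2_H2 C_alpha_K2[OF \<alpha>])
    have "ip (\<lambda>t. \<phi> t * C_alpha \<alpha> f t) (C_alpha \<alpha> g) = ip (\<lambda>t. \<phi> t * g t) f"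
    proof (rule ip_cong_AE)
      show "AE t in circ. \<phi> t * C_alpha \<alpha> f t * cnj (C_alpha \<alpha> g t) = \<phi> t * g t * cnj (f t)"
        using inner_mult_cnj[OF \<alpha>]
      proof eventually_elim
        case (elim t)
        have "zc t * cnj (zc t) = 1"
          by (simp add: zc_eq_chi cnj_chi chi_mult)
        have "\<phi> t * C_alpha \<alpha> f t * cnj (C_alpha \<alpha> g t)
            = (\<alpha> t * cnj (\<alpha> t)) * (zc t * cnj (zc t)) * (\<phi> t * g t * cnj (f t))"
          by (simp add: C_alpha_def)
        with elim \<open>zc t * cnj (zc t) = 1\<close> show ?case by simp
      qed
    qed (use C f g \<phi> in \<open>auto intro: Linf_mult_L2 H2_L2 K2_L2\<close>)
    then show ?thesis using C f g by (simp add: ipA K2_H2)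
  qed
  then show ?thesis by (simp add: conj_symm_iff[where A = A, OF \<alpha> A])
qed

lemma inner_fun_zc_power:
  assumes "n \<ge> 1"
  shows "inner_fun (\<lambda>t. zc t ^ n)" "nonconstant (\<lambda>t. zc t ^ n)"
proof -
  show "inner_fun (\<lambda>t. zc t ^ n)"
    unfolding zc_power inner_fun_def by (simp add: chi_H2 chi_Linf)
  show "nonconstant (\<lambda>t. zc t ^ n)"
    unfolding zc_power nonconstant_def
  proof
    assume "\<exists>c. AE t in circ. chi (int n) t = c"
    then obtain c where c: "AE t in circ. chi (int n) t = c" ..
    \<comment> \<open>If z^n were the constant c, its pairing with itself, which is 1, would equal c
      times the pairing of 1 with z^n, which is 0 for n at least 1.\<close>
    have "ip (chi (int n)) (chi (int n)) = ip (\<lambda>t. c * chi 0 t) (chi (int n))"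
      by (rule ip_cong_AE) (use c L2_cmult[OF chi_L2, of c 0] in auto)
    then show False
      using assms unfolding ip_cmult_left ip_chi_chi by simp
  qed
qed

subsection \<open>Operators with a Toeplitz matrix\<close>

text \<open>Only an upper bound has to be shown, since the means are nonnegative: the first N terms
  contribute a constant over n, and the others at most e / 2.\<close>

lemma cesaro_null:
  fixes x :: "nat \<Rightarrow> real"
  assumes x: "x \<longlonglongrightarrow> 0" and nonneg: "\<And>n. x n \<ge> 0"
  shows "(\<lambda>n. (\<Sum>m<n. x m) / n) \<longlonglongrightarrow> 0"
proof (rule LIMSEQ_I)
  fix e :: real assume "e > 0"
  then obtain N where N: "\<And>n. n \<ge> N \<Longrightarrow> x n < e / 2"
    using order_tendstoD(2)[OF x, of "e / 2"] by (auto simp: eventually_sequentially)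
  define K where "K = (\<Sum>m<N. x m)"
  have "(\<lambda>n. K / real n) \<longlonglongrightarrow> 0"
    by (rule lim_const_over_n)
  then obtain N' where N': "\<And>n. n \<ge> N' \<Longrightarrow> K / real n < e / 2"
    using order_tendstoD(2)[of "\<lambda>n. K / real n" 0 sequentially "e / 2"] \<open>e > 0\<close>
    by (auto simp: eventually_sequentially)
  have "norm ((\<Sum>m<n. x m) / n - 0) < e" if n: "n \<ge> max (max N N') 1" for n
  proof -
    have "(\<Sum>m<n. x m) = K + (\<Sum>m\<in>{N..<n}. x m)"
      unfolding K_def using n by (subst sum.union_disjoint[symmetric]) (auto intro!: sum.cong)
    also have "(\<Sum>m\<in>{N..<n}. x m) \<le> (\<Sum>m\<in>{N..<n}. e / 2)"
      by (rule sum_mono) (use N in \<open>auto intro: less_imp_le\<close>)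
    also have "\<dots> = real (n - N) * (e / 2)" by simp
    also have "\<dots> \<le> real n * (e / 2)"
      using \<open>e > 0\<close> by (intro mult_right_mono) auto
    finally have "(\<Sum>m<n. x m) / n \<le> (K + real n * (e / 2)) / n"
      by (intro divide_right_mono) auto
    also have "\<dots> = K / n + e / 2"
      using n by (simp add: field_simps)
    also have "\<dots> < e / 2 + e / 2" using N'[of n] n by (intro add_strict_right_mono) simp
    also have "\<dots> = e" by simp
    finally show ?thesis using nonneg by (simp add: sum_nonneg)
  qed
  then show "\<exists>M. \<forall>n\<ge>M. norm ((\<Sum>m<n. x m) / n - 0) < e" by blast
qed

text \<open>Enlarging the square from n to n + 1 adds a row, a column and a corner, along which j -
  i takes each value from - n to n exactly once. This turns the quadratic form of a Toeplitz matrix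
  into a sum of symmetric partial sums.\<close>

lemma sum_differences:
  fixes F :: "int \<Rightarrow> 'a :: comm_monoid_add"
  shows "(\<Sum>i<n. \<Sum>j<n. F (int j - int i)) = (\<Sum>m<n. \<Sum>k\<in>{- int m..int m}. F k)"
proof (induction n)
  case (Suc n)
  have "{- int n..int n} = (\<lambda>i. int n - int i) ` {..<n} \<union> (insert 0 ((\<lambda>j. int j - int n) ` {..<n}))"
  proof (intro equalityI subsetI)
    fix k assume k: "k \<in> {- int n..int n}"
    consider "k > 0" | "k = 0" | "k < 0" by linarith
    then show "k \<in> (\<lambda>i. int n - int i) ` {..<n} \<union> (insert 0 ((\<lambda>j. int j - int n) ` {..<n}))"
    proof cases
      case 1
      then have "k = int n - int (nat (int n - k))" "nat (int n - k) < n" using k by auto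
      then show ?thesis by blast
    next
      case 3
      then have "k = int (nat (int n + k)) - int n" "nat (int n + k) < n" using k by auto
      then show ?thesis by blast
    qed simp
  qed auto
  then have "(\<Sum>k\<in>{- int n..int n}. F k)
      = (\<Sum>k\<in>(\<lambda>i. int n - int i) ` {..<n}. F k) + (\<Sum>k\<in>insert 0 ((\<lambda>j. int j - int n) ` {..<n}). F k)"
    by (simp only:) (rule sum.union_disjoint, auto)
  also have "(\<Sum>k\<in>(\<lambda>i. int n - int i) ` {..<n}. F k) = (\<Sum>i<n. F (int n - int i))"
    by (subst sum.reindex) (auto simp: inj_on_def)
  also have "(\<Sum>k\<in>insert 0 ((\<lambda>j. int j - int n) ` {..<n}). F k) = F 0 + (\<Sum>j<n. F (int j - int n))"
    by (subst sum.insert) (auto simp: sum.reindex inj_on_def)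
  finally show ?case
    by (simp add: sum.distrib Suc.IH[symmetric] ac_simps)
qed simp

lemma L2norm_chi: "L2norm (chi n) = 1"
  by (simp add: L2norm_def)

text \<open>The bound \<open>C\<close> is fixed as a parameter since it reappears as the essential
  bound of the symbol.\<close>

locale bounded_operator =
  fixes A :: "(real \<Rightarrow> complex) \<Rightarrow> (real \<Rightarrow> complex)" and C :: real
  assumes A_H2: "f \<in> H2 \<Longrightarrow> A f \<in> H2"
    and A_lin: "f \<in> H2 \<Longrightarrow> g \<in> H2 \<Longrightarrow> AE t in circ. A (\<lambda>s. a * f s + b * g s) t = a * A f t + b * A g t"
    and A_bound: "f \<in> H2 \<Longrightarrow> L2norm (A f) \<le> C * L2norm f"
begin

lemma A_L2: "f \<in> H2 \<Longrightarrow> A f \<in> L2"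
  by (simp add: A_H2 H2_L2)

text \<open>\<open>A\<close> is linear only up to null sets; inside an inner product this becomes a
  true equality.\<close>

lemma ip_A_lin:
  assumes "f \<in> H2" "g \<in> H2" "h \<in> L2"
  shows "ip (A (\<lambda>s. a * f s + b * g s)) h = a * ip (A f) h + b * ip (A g) h"
proof -
  have "ip (A (\<lambda>s. a * f s + b * g s)) h = ip (\<lambda>t. a * A f t + b * A g t) h"
  proof (rule ip_cong_AE)
    show "AE t in circ. A (\<lambda>s. a * f s + b * g s) t * cnj (h t) = (a * A f t + b * A g t) * cnj (h t)"
      using A_lin[OF assms(1,2), of a b] by eventually_elim simp
  qed (use assms in \<open>auto intro!: A_L2 H2_add H2_cmult L2_add L2_cmult\<close>)
  also have "\<dots> = a * ip (A f) h + b * ip (A g) h"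
    using assms by (simp add: ip_add_left L2_cmult A_L2 ip_cmult_left)
  finally show ?thesis .
qed

lemma ip_A_sum:
  assumes "\<And>i. i \<in> I \<Longrightarrow> h i \<in> H2" "g \<in> L2" "finite I"
  shows "ip (A (\<lambda>t. \<Sum>i\<in>I. c i * h i t)) g = (\<Sum>i\<in>I. c i * ip (A (h i)) g)"
  using assms(3,1)
proof (induction I rule: finite_induct)
  case empty
  then show ?case
    \<comment> \<open>Linearity with both scalars 0 says that the image of the zero function pairs
      to 0.\<close>
    using ip_A_lin[OF H2_zero H2_zero assms(2), of 0 0] by simp
next
  case (insert x F)
  have "ip (A (\<lambda>t. c x * h x t + 1 * (\<Sum>i\<in>F. c i * h i t))) g
      = c x * ip (A (h x)) g + 1 * ip (A (\<lambda>t. \<Sum>i\<in>F. c i * h i t)) g"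
    by (rule ip_A_lin) (use insert assms(2) in \<open>auto intro!: H2_sum H2_cmult\<close>)
  then show ?case using insert by simp
qed

lemma ip_A_tendsto:
  assumes s: "\<And>n. s n \<in> H2" and f: "f \<in> H2" and g: "g \<in> L2"
    and lim: "(\<lambda>n. L2norm (\<lambda>t. s n t - f t)) \<longlonglongrightarrow> 0"
  shows "(\<lambda>n. ip (A (s n)) g) \<longlonglongrightarrow> ip (A f) g"
proof (rule LIM_zero_cancel, rule Lim_null_comparison)
  have d: "(\<lambda>t. s n t - f t) \<in> H2" for n
    by (rule H2_diff[OF s f])
  have "norm (ip (A (s n)) g - ip (A f) g) \<le> C * L2norm (\<lambda>t. s n t - f t) * L2norm g" for n
  proof -
    have "ip (A (s n)) g - ip (A f) g = ip (A (\<lambda>t. s n t - f t)) g"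
      using ip_A_lin[OF s[of n] f g, of 1 "- 1"] by simp
    also have "norm \<dots> \<le> L2norm (A (\<lambda>t. s n t - f t)) * L2norm g"
      by (rule ip_Cauchy_Schwarz[OF A_L2[OF d] g])
    also have "\<dots> \<le> C * L2norm (\<lambda>t. s n t - f t) * L2norm g"
      by (intro mult_right_mono A_bound d) simp
    finally show ?thesis .
  qed
  then show "\<forall>\<^sub>F n in sequentially. norm (ip (A (s n)) g - ip (A f) g) \<le> C * L2norm (\<lambda>t. s n t - f t) * L2norm g"
    by simp
  show "(\<lambda>n. C * L2norm (\<lambda>t. s n t - f t) * L2norm g) \<longlonglongrightarrow> 0"
    using tendsto_mult_right[OF tendsto_mult_left[OF lim, of C], of "L2norm g"] by simp
qed

end

text \<open>For a Toeplitz operator the entry depends on j - i and is the Fourier coefficient of the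
  symbol at j - i, so \<open>a\<close> is the candidate for the coefficients of the symbol.\<close>

locale toeplitz_matrix = bounded_operator +
  fixes a :: "int \<Rightarrow> complex"
  assumes matrix: "i \<ge> 0 \<Longrightarrow> j \<ge> 0 \<Longrightarrow> ip (A (chi i)) (chi j) = a (j - i)"
begin

text \<open>The values a (- n), ..., a n occur together as the coefficients 0 to 2 n of
  \<open>A (chi n)\<close>, a vector of norm at most C, so Bessel bounds them uniformly in
  n.\<close>

lemma coeff_bound: "(\<Sum>k\<in>{- int n..int n}. (cmod (a k))\<^sup>2) \<le> C\<^sup>2"
proof -
  have "(\<Sum>k\<in>{- int n..int n}. (cmod (a k))\<^sup>2) = (\<Sum>k\<in>{- int n..int n}. (cmod (fcoef (A (chi (int n))) (int n + k)))\<^sup>2)"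
    by (rule sum.cong) (auto simp: fcoef_eq matrix)
  also have "\<dots> = (\<Sum>k\<in>(\<lambda>k. int n + k) ` {- int n..int n}. (cmod (fcoef (A (chi (int n))) k))\<^sup>2)"
    by (subst sum.reindex) (auto simp: inj_on_def)
  also have "\<dots> \<le> (L2norm (A (chi (int n))))\<^sup>2"
    by (rule Bessel) (simp_all add: A_L2 chi_H2)
  also have "\<dots> \<le> C\<^sup>2"
    using A_bound[OF chi_H2[of "int n"]] by (intro power_mono) (auto simp: L2norm_chi)
  finally show ?thesis .
qed

text \<open>The Fejer mean at \<open>s\<close> is the Rayleigh quotient of \<open>A\<close> at the polynomial \<open>p\<close> with coefficients \<open>cnj (chi j s)\<close>, \<open>j < n\<close>.\<close>

lemma Fejer_bound: "cmod (\<Sum>m<n. psum a m s) \<le> C * real n"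
proof -
  define p where "p t = (\<Sum>j<n. cnj (chi (int j) s) * chi (int j) t)" for t
  have pH: "p \<in> H2"
    unfolding p_def[abs_def] by (intro H2_sum H2_cmult chi_H2) simp
  have np: "(L2norm p)\<^sup>2 = real n"
  proof -
    have "p t = (\<Sum>k\<in>int ` {..<n}. cnj (chi k s) * chi k t)" for t
      unfolding p_def by (subst sum.reindex) auto
    then have "p = (\<lambda>t. \<Sum>k\<in>int ` {..<n}. cnj (chi k s) * chi k t)" by auto
    then have "(L2norm p)\<^sup>2 = (\<Sum>k\<in>int ` {..<n}. (cmod (cnj (chi k s)))\<^sup>2)"
      by (simp only:) (rule L2norm_trig, simp)
    then show ?thesis by (simp add: card_image)
  qed
  have "ip (A p) p = (\<Sum>i<n. cnj (chi (int i) s) * ip (A (chi (int i))) p)"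
    by (subst p_def[abs_def], rule ip_A_sum) (auto intro: chi_H2 H2_L2[OF pH])
  \<comment> \<open>The coefficients of p are chosen so that the characters at s also combine to a
    function of j - i.\<close>
  also have "\<dots> = (\<Sum>i<n. \<Sum>j<n. a (int j - int i) * chi (int j - int i) s)"
  proof (rule sum.cong[OF refl])
    fix i
    have "ip (A (chi (int i))) p = (\<Sum>j<n. cnj (cnj (chi (int j) s)) * ip (A (chi (int i))) (chi (int j)))"
      unfolding p_def[abs_def] by (rule ip_sum_right) (simp_all add: A_L2 chi_H2)
    moreover have "chi (int j - int i) s = cnj (chi (int i) s) * chi (int j) s" for j
      by (simp add: cnj_chi chi_mult)
    ultimately show "cnj (chi (int i) s) * ip (A (chi (int i))) p = (\<Sum>j<n. a (int j - int i) * chi (int j - int i) s)"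
      by (simp add: matrix sum_distrib_left mult_ac)
  qed
  also have "\<dots> = (\<Sum>m<n. psum a m s)"
    unfolding psum_def by (rule sum_differences)
  finally have "cmod (\<Sum>m<n. psum a m s) \<le> L2norm (A p) * L2norm p"
    using ip_Cauchy_Schwarz[OF A_L2[OF pH] H2_L2[OF pH]] by simp
  also have "\<dots> \<le> C * L2norm p * L2norm p"
    by (intro mult_right_mono A_bound pH) simp
  finally show ?thesis unfolding np[symmetric] by (simp add: power2_eq_square mult.assoc)
qed

text \<open>The averages of the partial sums converge to \<phi> in norm, hence almost everywhere
  along a subsequence, and the bound C on the Fejer means passes to the limit.\<close>

lemma bounded_symbol:
  assumes \<phi>: "\<phi> \<in> L2" "(\<lambda>n. L2norm (\<lambda>t. psum a n t - \<phi> t)) \<longlonglongrightarrow> 0"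
  shows "\<phi> \<in> Linf"
proof -
  define d where "d n t = (1 / of_nat n) * (\<Sum>m<n. psum a m t) - \<phi> t" for n t
  have dL: "d n \<in> L2" for n
    unfolding d_def[abs_def] by (intro L2_diff L2_cmult L2_sum psum_L2 \<phi>(1))
  have le: "L2norm (d n) \<le> (\<Sum>m<n. L2norm (\<lambda>t. psum a m t - \<phi> t)) / n" if "n \<ge> 1" for n
  proof -
    \<comment> \<open>For n at least 1, \<phi> is the average of n copies of itself and can be moved
      under the sum.\<close>
    have "d n = (\<lambda>t. (1 / of_nat n) * (\<Sum>m<n. psum a m t - \<phi> t))"
      using that by (auto simp: d_def fun_eq_iff sum_subtractf right_diff_distrib)
    then have "L2norm (d n) = cmod (1 / of_nat n) * L2norm (\<lambda>t. \<Sum>m<n. psum a m t - \<phi> t)"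
      by (simp only: L2norm_cmult)
    also have "\<dots> \<le> cmod (1 / of_nat n) * (\<Sum>m<n. L2norm (\<lambda>t. psum a m t - \<phi> t))"
      by (intro mult_left_mono L2norm_sum L2_diff psum_L2 \<phi>(1)) simp
    finally show ?thesis by (simp add: norm_divide)
  qed
  have "(\<lambda>n. \<integral>t. cmod (d n t) \<partial>circ) \<longlonglongrightarrow> 0"
  proof (rule Lim_null_comparison)
    show "\<forall>\<^sub>F n in sequentially. norm (\<integral>t. cmod (d n t) \<partial>circ) \<le> (\<Sum>m<n. L2norm (\<lambda>t. psum a m t - \<phi> t)) / n"
      using eventually_ge_at_top[of 1]
    proof eventually_elim
      case (elim n)
      then show ?case using order_trans[OF L1_le_L2norm[OF dL] le] by simp
    qed
    show "(\<lambda>n. (\<Sum>m<n. L2norm (\<lambda>t. psum a m t - \<phi> t)) / n) \<longlonglongrightarrow> 0"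
      by (rule cesaro_null[OF \<phi>(2)]) simp
  qed
  from tendsto_L1_AE_subseq[OF L2_integrable[OF dL] this]
  obtain r :: "nat \<Rightarrow> nat" where r: "strict_mono r" "AE t in circ. (\<lambda>n. d (r n) t) \<longlonglongrightarrow> 0" by blast
  have "AE t in circ. cmod (\<phi> t) \<le> C"
    using r(2)
  proof eventually_elim
    case (elim t)
    have "cmod (\<phi> t) \<le> C + cmod (d (r n) t)" if "n \<ge> 1" for n
    proof -
      have "r n \<ge> 1" using seq_suble[OF r(1), of n] that by simp
      have "\<phi> t = (1 / of_nat (r n)) * (\<Sum>m<r n. psum a m t) - d (r n) t"
        by (simp add: d_def)
      then have "cmod (\<phi> t) \<le> cmod ((1 / of_nat (r n)) * (\<Sum>m<r n. psum a m t)) + cmod (d (r n) t)"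
        by (simp only: norm_triangle_ineq4)
      also have "cmod ((1 / of_nat (r n)) * (\<Sum>m<r n. psum a m t)) \<le> C"
        using Fejer_bound[of t "r n"] \<open>r n \<ge> 1\<close> by (simp add: norm_mult norm_divide field_simps)
      finally show ?thesis by simp
    qed
    moreover have "(\<lambda>n. C + cmod (d (r n) t)) \<longlonglongrightarrow> C + 0"
      by (intro tendsto_add tendsto_const tendsto_norm_zero elim)
    ultimately show ?case
      by (intro LIMSEQ_le_const[where X = "\<lambda>n. C + cmod (d (r n) t)"]) auto
  qed
  then show ?thesis using \<phi>(1) by (auto simp: Linf_def)
qed

text \<open>The two operators are compared through Fourier coefficients. Those of negative index
  vanish for both images; the others agree on analytic polynomials by the matrix condition, and on
  all of H2 by continuity.\<close>

theorem Brown_Halmos: "\<exists>\<phi>\<in>Linf. \<forall>f\<in>H2. AE t in circ. A f t = toeplitz \<phi> f t"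
proof -
  obtain \<phi> where \<phi>: "\<phi> \<in> L2" "\<And>k. fcoef \<phi> k = a k"
      "(\<lambda>n. L2norm (\<lambda>t. psum a n t - \<phi> t)) \<longlonglongrightarrow> 0"
    using Riesz_Fischer[OF coeff_bound] by auto
  have \<phi>L: "\<phi> \<in> Linf" by (rule bounded_symbol[OF \<phi>(1,3)])
  have "AE t in circ. A f t = toeplitz \<phi> f t" if f: "f \<in> H2" for f
  proof -
    have \<phi>f: "(\<lambda>t. \<phi> t * f t) \<in> L2" by (intro Linf_mult_L2 \<phi>L H2_L2 f)
    have T: "toeplitz \<phi> f \<in> H2" unfolding toeplitz_def by (rule P_works[OF \<phi>f])
    have "fcoef (A f) k = fcoef (toeplitz \<phi> f) k" for k
    proof (cases "k < 0")
      case True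
      then show ?thesis using f T by (simp add: H2_fcoef A_H2)
    next
      case False
      \<comment> \<open>Moving the symbol to the other side turns f |-> ip (\<phi> f) (chi k) into
        pairing with this fixed \<open>g\<close>, which is continuous in f.\<close>
      define g where "g t = cnj (\<phi> t) * chi k t" for t
      have g: "g \<in> L2" unfolding g_def[abs_def] by (intro Linf_mult_L2 cnj_Linf \<phi>L chi_L2)
      have chi_g: "ip (chi i) g = a (k - i)" for i
        using fcoef_chi_mult[of i \<phi> k] \<phi>(2)[of "k - i"]
        by (simp add: g_def[abs_def] ip_mult_left[symmetric] fcoef_eq mult.commute)
      define s where "s n t = (\<Sum>i\<in>{0..int n}. fcoef f i * chi i t)" for n t
      \<comment> \<open>The negative coefficients of \<open>f\<close> vanish, so its symmetric
        partial sums are analytic polynomials, to which \<open>A\<close> applies.\<close>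
      have s: "psum (fcoef f) n = s n" for n
        unfolding psum_def[abs_def] s_def[abs_def]
        by (intro ext sum.mono_neutral_right) (auto simp: H2_fcoef[OF f])
      have sH: "s n \<in> H2" for n
        unfolding s_def[abs_def] by (intro H2_sum H2_cmult chi_H2) simp
      have lim: "(\<lambda>n. L2norm (\<lambda>t. s n t - f t)) \<longlonglongrightarrow> 0"
        using Fourier_series_L2[OF H2_L2[OF f]] unfolding s .
      have "ip (A (s n)) (chi k) = ip (s n) g" for n
      proof -
        have "ip (A (s n)) (chi k) = (\<Sum>i\<in>{0..int n}. fcoef f i * ip (A (chi i)) (chi k))"
          unfolding s_def[abs_def] by (rule ip_A_sum) (auto intro: chi_H2)
        also have "\<dots> = (\<Sum>i\<in>{0..int n}. fcoef f i * ip (chi i) g)"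
          by (rule sum.cong) (use False in \<open>auto simp: matrix chi_g\<close>)
        also have "\<dots> = ip (s n) g"
          unfolding s_def[abs_def] by (rule ip_sum_left[symmetric]) (auto simp: g)
        finally show ?thesis .
      qed
      then have "(\<lambda>n. ip (s n) g) \<longlonglongrightarrow> ip (A f) (chi k)"
        using ip_A_tendsto[OF sH f chi_L2 lim, of k] by simp
      moreover have "(\<lambda>n. ip (s n) g) \<longlonglongrightarrow> ip f g"
        by (rule ip_tendsto_left[OF H2_L2[OF sH] H2_L2[OF f] g lim])
      ultimately have "ip (A f) (chi k) = ip f g"
        by (rule LIMSEQ_unique)
      also have "\<dots> = ip (\<lambda>t. \<phi> t * f t) (chi k)"
        by (simp add: ip_mult_left g_def[abs_def])
      also have "\<dots> = ip (toeplitz \<phi> f) (chi k)"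
        unfolding toeplitz_def using False by (intro P_works(2)[OF \<phi>f, symmetric] chi_H2) simp
      finally show ?thesis by (simp add: fcoef_eq)
    qed
    then show ?thesis
      by (intro AE_eq_of_fcoef_eq A_L2 H2_L2[OF T] f)
  qed
  with \<phi>L show ?thesis by blast
qed

end

section \<open>From symmetric compressions to a Toeplitz matrix, and the equivalence\<close>

lemma chi_K2:
  assumes "0 \<le> j" "j < int n"
  shows "chi j \<in> K2 (\<lambda>t. zc t ^ n)"
proof -
  have "ip (chi j) (\<lambda>t. zc t ^ n * g t) = 0" if "g \<in> H2" for g
  proof -
    \<comment> \<open>This is the conjugate of coefficient j - n of g, whose index is
      negative.\<close>
    have "ip (chi j) (\<lambda>t. zc t ^ n * g t) = cnj (fcoef (\<lambda>t. chi (int n) t * g t) j)"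
      unfolding fcoef_eq ip_cnj zc_power ..
    then show ?thesis using assms that by (simp add: fcoef_chi_mult H2_fcoef)
  qed
  then show ?thesis using assms by (simp add: K2_def chi_H2)
qed

lemma C_alpha_chi: "C_alpha (\<lambda>t. zc t ^ n) (chi j) = chi (int n - 1 - j)"
proof
  fix t
  have "C_alpha (\<lambda>t. zc t ^ n) (chi j) t = chi (int n) t * cnj (chi 1 t * chi j t)"
    unfolding C_alpha_def zc_power zc_eq_chi[symmetric] ..
  then show "C_alpha (\<lambda>t. zc t ^ n) (chi j) t = chi (int n - 1 - j) t"
    by (simp only: chi_mult cnj_chi) (simp add: algebra_simps)
qed

text \<open>The condition for z^n reflects the leading n by n block of the matrix in its
  antidiagonal. Two such reflections, for n and n + 1, compose to a shift by one along the diagonal.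
  The right-hand side is the entry where that diagonal meets the first row or column, so it depends
  only on j - i.\<close>

lemma conj_symm_zc_power_toeplitz:
  assumes A: "\<And>f. f \<in> H2 \<Longrightarrow> A f \<in> H2"
    and conj: "\<And>n::nat. n \<ge> 1 \<Longrightarrow> conj_symm A (\<lambda>t. zc t ^ n)"
    and ij: "i \<ge> 0" "j \<ge> 0"
  shows "ip (A (chi i)) (chi j) = ip (A (chi (max 0 (i - j)))) (chi (max 0 (j - i)))"
proof -
  define M where "M i j = ip (A (chi i)) (chi j)" for i j
  have flip: "M (int n - 1 - j) (int n - 1 - i) = M i j"
    if "0 \<le> i" "i < int n" "0 \<le> j" "j < int n" for i j n
  proof -
    have "n \<ge> 1" using that by simp
    note iff = conj_symm_iff[where A = A, OF inner_fun_zc_power(1)[OF this] A, THEN iffD1, OF _ conj[OF this]]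
    have "ip (A (C_alpha (\<lambda>t. zc t ^ n) (chi j))) (C_alpha (\<lambda>t. zc t ^ n) (chi i)) = ip (A (chi i)) (chi j)"
      by (rule iff[THEN bspec, THEN bspec]) (auto intro: chi_K2 that)
    then show ?thesis unfolding M_def C_alpha_chi .
  qed
  have step: "M (i + 1) (j + 1) = M i j" if "0 \<le> i" "0 \<le> j" for i j
  proof -
    \<comment> \<open>This n exceeds both i and j, so (i, j) lies in the block of size n and (i + 1,
      j + 1) in the block of size n + 1.\<close>
    define n where "n = nat (i + j + 1)"
    have n: "int n = i + j + 1" using that by (simp add: n_def)
    have "M (i + 1) (j + 1) = M (int (Suc n) - 1 - (j + 1)) (int (Suc n) - 1 - (i + 1))"
      by (rule flip[symmetric]) (use that n in auto)
    also have "\<dots> = M (int n - 1 - j) (int n - 1 - i)" by (simp add: algebra_simps)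
    also have "\<dots> = M i j"
      by (rule flip) (use that n in auto)
    finally show ?thesis .
  qed
  have shift: "M (i + int k) (j + int k) = M i j" if "0 \<le> i" "0 \<le> j" for i j k
  proof (induction k)
    case (Suc k)
    then show ?case using step[of "i + int k" "j + int k"] that by (simp add: algebra_simps)
  qed simp
  have "M i j = M (max 0 (i - j)) (max 0 (j - i))"
  proof -
    \<comment> \<open>The pair (i, j) is reached from the border of the matrix by min i j diagonal
      steps.\<close>
    have "i = max 0 (i - j) + int (nat (min i j))" "j = max 0 (j - i) + int (nat (min i j))"
      using ij by auto
    then show ?thesis
      using shift[of "max 0 (i - j)" "max 0 (j - i)" "nat (min i j)"] by simp
  qed
  then show ?thesis unfolding M_def .
qed

theorem theorem2p2:
  fixes A :: "(real \<Rightarrow> complex) \<Rightarrow> (real \<Rightarrow> complex)"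
  assumes "bounded_op_H2 A"
  shows "((\<exists>\<phi>\<in>Linf. \<forall>f\<in>H2. AE t in circ. A f t = toeplitz \<phi> f t)
            \<longleftrightarrow> (\<forall>\<alpha>. inner_fun \<alpha> \<and> nonconstant \<alpha> \<longrightarrow> conj_symm A \<alpha>))
       \<and> ((\<forall>\<alpha>. inner_fun \<alpha> \<and> nonconstant \<alpha> \<longrightarrow> conj_symm A \<alpha>)
            \<longleftrightarrow> (\<forall>n::nat. n \<ge> 1 \<longrightarrow> conj_symm A (\<lambda>t. zc t ^ n)))"
proof -
  have A: "f \<in> H2 \<Longrightarrow> A f \<in> H2" for f
    using assms by (simp add: bounded_op_H2_def)
  obtain C where "bounded_operator A C"
    using assms unfolding bounded_op_H2_def bounded_operator_def by blast
  then interpret bounded_operator A C .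
  have 1: "conj_symm A \<alpha>"
    if "\<phi> \<in> Linf" "\<forall>f\<in>H2. AE t in circ. A f t = toeplitz \<phi> f t" "inner_fun \<alpha>" for \<phi> \<alpha>
    by (rule toeplitz_conj_symm[where A = A, OF A that(1) _ that(3)]) (use that(2) in auto)
  have 2: "conj_symm A (\<lambda>t. zc t ^ n)"
    if "\<forall>\<alpha>. inner_fun \<alpha> \<and> nonconstant \<alpha> \<longrightarrow> conj_symm A \<alpha>" "n \<ge> 1" for n :: nat
    using that inner_fun_zc_power[of n] by blast
  have 3: "\<exists>\<phi>\<in>Linf. \<forall>f\<in>H2. AE t in circ. A f t = toeplitz \<phi> f t"
    if "\<forall>n::nat. n \<ge> 1 \<longrightarrow> conj_symm A (\<lambda>t. zc t ^ n)"
  proof -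
    \<comment> \<open>Coefficient k is read off at column 0 for k nonnegative, from the image of 1,
      and otherwise from the constant term of the image of z^(-k).\<close>
    interpret toeplitz_matrix A C "\<lambda>k. ip (A (chi (max 0 (- k)))) (chi (max 0 k))"
    proof unfold_locales
      fix i j :: int
      assume "i \<ge> 0" "j \<ge> 0"
      then have "ip (A (chi i)) (chi j) = ip (A (chi (max 0 (i - j)))) (chi (max 0 (j - i)))"
        using that by (intro conj_symm_zc_power_toeplitz A) auto
      then show "ip (A (chi i)) (chi j) = ip (A (chi (max 0 (- (j - i))))) (chi (max 0 (j - i)))"
        by simp
    qed
    show ?thesis by (rule Brown_Halmos)
  qed
  show ?thesis
    by (intro conjI iffI) (use 1 2 3 in \<open>blast+\<close>)
qed

end
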